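(* As $\mathfrak{u}(\mathfrak{m})$-modules, $V_1\otimes V_1\simeq V_0\oplus P_1$.
   Context: $\Bbbk$ is an algebraically closed field of characteristic $2$. $\mathfrak{u}(\mathfrak{m})$ is the unital associative $\Bbbk$-algebra generated by $a,b,c$ with relations $ab+ba=c$, $ac+ca=a$, $bc+cb=b$, $a^4=b^4=0$, $c^2+c=0$; it is a Hopf algebra in which $a,b,c$ are primitive, and tensor products of modules are over $\Bbbk$ with action through the comultiplication. $V_0$ is the trivial one-dimensional module and $V_1$ is the simple module with basis $v_1,v_2,v_3$ and $av_1=v_2$, $av_2=v_3$, $av_3=0$, $bv_1=0$, $bv_2=v_1$, $bv_3=v_2$, $cv_1=v_1$, $cv_2=0$, $cv_3=v_3$. $P_1$ is the projective cover of $V_1$. *)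

theory Defs
  imports
    "HOL-Analysis.Analysis"
    "HOL-Algebra.QuotRing"
    "HOL-Algebra.Module"
    "HOL-Library.Poly_Mapping"
    "HOL-Computational_Algebra.Polynomial"
begin

section \<open>Left modules over a not necessarily commutative ring\<close>

text \<open>
  The locale \<^locale>\<open>module\<close> requires a commutative ring of scalars.  As in HOL-Algebra, the
  fields \<open>mult\<close> and \<open>one\<close> of a record of type \<open>module\<close> are irrelevant when the record is only
  used as a module.
\<close>

locale left_module = R?: ring R + M?: abelian_group M
  for R (structure) and M (structure) +
  assumes smult_closed:
      "\<lbrakk>r \<in> carrier R; x \<in> carrier M\<rbrakk> \<Longrightarrow> r \<odot>\<^bsub>M\<^esub> x \<in> carrier M"
    and smult_l_distr:
      "\<lbrakk>r \<in> carrier R; s \<in> carrier R; x \<in> carrier M\<rbrakk> \<Longrightarrow>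
        (r \<oplus>\<^bsub>R\<^esub> s) \<odot>\<^bsub>M\<^esub> x = r \<odot>\<^bsub>M\<^esub> x \<oplus>\<^bsub>M\<^esub> s \<odot>\<^bsub>M\<^esub> x"
    and smult_r_distr:
      "\<lbrakk>r \<in> carrier R; x \<in> carrier M; y \<in> carrier M\<rbrakk> \<Longrightarrow>
        r \<odot>\<^bsub>M\<^esub> (x \<oplus>\<^bsub>M\<^esub> y) = r \<odot>\<^bsub>M\<^esub> x \<oplus>\<^bsub>M\<^esub> r \<odot>\<^bsub>M\<^esub> y"
    and smult_assoc:
      "\<lbrakk>r \<in> carrier R; s \<in> carrier R; x \<in> carrier M\<rbrakk> \<Longrightarrow>
        (r \<otimes>\<^bsub>R\<^esub> s) \<odot>\<^bsub>M\<^esub> x = r \<odot>\<^bsub>M\<^esub> (s \<odot>\<^bsub>M\<^esub> x)"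
    and smult_one:
      "x \<in> carrier M \<Longrightarrow> \<one>\<^bsub>R\<^esub> \<odot>\<^bsub>M\<^esub> x = x"

definition mod_hom ::
  "('r, 'x) ring_scheme \<Rightarrow> ('r, 'm, 'y) module_scheme \<Rightarrow> ('r, 'n, 'z) module_scheme \<Rightarrow> ('m \<Rightarrow> 'n) set"
  where "mod_hom R M N =
    {h. h \<in> carrier M \<rightarrow> carrier N \<and>
        (\<forall>x\<in>carrier M. \<forall>y\<in>carrier M. h (x \<oplus>\<^bsub>M\<^esub> y) = h x \<oplus>\<^bsub>N\<^esub> h y) \<and>
        (\<forall>r\<in>carrier R. \<forall>x\<in>carrier M. h (r \<odot>\<^bsub>M\<^esub> x) = r \<odot>\<^bsub>N\<^esub> h x)}"

definition mod_isomorphic ::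
  "('r, 'x) ring_scheme \<Rightarrow> ('r, 'm, 'y) module_scheme \<Rightarrow> ('r, 'n, 'z) module_scheme \<Rightarrow> bool"
  where "mod_isomorphic R M N \<longleftrightarrow>
    left_module R M \<and> left_module R N \<and>
    (\<exists>h\<in>mod_hom R M N. bij_betw h (carrier M) (carrier N))"

definition mod_direct_sum ::
  "('r, 'm, 'y) module_scheme \<Rightarrow> ('r, 'n, 'z) module_scheme \<Rightarrow> ('r, 'm \<times> 'n) module"
  where "mod_direct_sum M N =
    \<lparr>carrier = carrier M \<times> carrier N,
     mult = undefined, one = undefined,
     zero = (\<zero>\<^bsub>M\<^esub>, \<zero>\<^bsub>N\<^esub>),
     add = (\<lambda>(x, y) (x', y'). (x \<oplus>\<^bsub>M\<^esub> x', y \<oplus>\<^bsub>N\<^esub> y')),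
     smult = (\<lambda>r (x, y). (r \<odot>\<^bsub>M\<^esub> x, r \<odot>\<^bsub>N\<^esub> y))\<rparr>"

text \<open>
  The lifting property.  HOL cannot quantify over the types carrying the test modules \<open>M\<close> and \<open>N\<close>
  inside a definition.  The types chosen here lose nothing: \<open>N\<close> may be \<open>P\<close> itself and \<open>M\<close> the free
  module of finitely supported functions from \<open>carrier P\<close> to \<open>R\<close>.  The property hence already makes
  \<open>P\<close> a direct summand of a free module, and so yields liftings against epimorphisms between
  arbitrary modules.
\<close>

definition projective_module :: "('r, 'x) ring_scheme \<Rightarrow> ('r, 'p, 'y) module_scheme \<Rightarrow> bool"
  where "projective_module R P \<longleftrightarrow>
    left_module R P \<and>
    (\<forall>(M :: ('r, 'p \<Rightarrow> 'r) module) (N :: ('r, 'p) module) g f.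
       left_module R M \<and> left_module R N \<and>
       g \<in> mod_hom R M N \<and> g ` carrier M = carrier N \<and> f \<in> mod_hom R P N \<longrightarrow>
       (\<exists>h\<in>mod_hom R P M. \<forall>x\<in>carrier P. g (h x) = f x))"

text \<open>A projective module together with an epimorphism onto \<open>V\<close> whose kernel is superfluous.\<close>

definition projective_cover ::
  "('r, 'x) ring_scheme \<Rightarrow> ('r, 'p, 'y) module_scheme \<Rightarrow> ('r, 'v, 'z) module_scheme \<Rightarrow> bool"
  where "projective_cover R P V \<longleftrightarrow>
    projective_module R P \<and> left_module R V \<and>
    (\<exists>\<pi>\<in>mod_hom R P V.
       \<pi> ` carrier P = carrier V \<and>
       (\<forall>H. submodule H R P \<and> H <+>\<^bsub>P\<^esub> a_kernel P V \<pi> = carrier P \<longrightarrow> H = carrier P))"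


section \<open>Tensor products over a field\<close>

text \<open>
  Vector spaces over the type \<open>'k\<close> are records of type \<open>('k, 'v) module\<close>, and \<open>'k\<close>-algebras are such
  records with \<open>mult\<close> and \<open>one\<close> used as well.
\<close>

definition scale_pm :: "'k::field \<Rightarrow> ('s \<Rightarrow>\<^sub>0 'k) \<Rightarrow> ('s \<Rightarrow>\<^sub>0 'k)"
  where "scale_pm c f = Poly_Mapping.map ((*) c) f"

definition free_space :: "'s set \<Rightarrow> ('k::field, 's \<Rightarrow>\<^sub>0 'k) module"
  where "free_space S =
    \<lparr>carrier = {f. Poly_Mapping.keys f \<subseteq> S},
     mult = undefined, one = undefined,
     zero = 0, add = (+), smult = scale_pm\<rparr>"

definition tensor_relators ::
  "('k::field, 'v, 'x) module_scheme \<Rightarrow> ('k, 'w, 'y) module_scheme \<Rightarrow> ('v \<times> 'w \<Rightarrow>\<^sub>0 'k) set"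
  where "tensor_relators V W =
    {Poly_Mapping.single (v \<oplus>\<^bsub>V\<^esub> v', w) 1 - Poly_Mapping.single (v, w) 1 - Poly_Mapping.single (v', w) 1
      | v v' w. v \<in> carrier V \<and> v' \<in> carrier V \<and> w \<in> carrier W} \<union>
    {Poly_Mapping.single (v, w \<oplus>\<^bsub>W\<^esub> w') 1 - Poly_Mapping.single (v, w) 1 - Poly_Mapping.single (v, w') 1
      | v w w'. v \<in> carrier V \<and> w \<in> carrier W \<and> w' \<in> carrier W} \<union>
    {Poly_Mapping.single (c \<odot>\<^bsub>V\<^esub> v, w) 1 - Poly_Mapping.single (v, w) c
      | c v w. v \<in> carrier V \<and> w \<in> carrier W} \<union>
    {Poly_Mapping.single (v, c \<odot>\<^bsub>W\<^esub> w) 1 - Poly_Mapping.single (v, w) c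
      | c v w. v \<in> carrier V \<and> w \<in> carrier W}"

text \<open>
  The class of \<open>f\<close> in the tensor product of \<open>V\<close> and \<open>W\<close>, which is the free space on the set of pairs
  modulo the span of the bilinearity relators.
\<close>

definition tensor_class ::
  "('k::field, 'v, 'x) module_scheme \<Rightarrow> ('k, 'w, 'y) module_scheme \<Rightarrow>
    ('v \<times> 'w \<Rightarrow>\<^sub>0 'k) \<Rightarrow> ('v \<times> 'w \<Rightarrow>\<^sub>0 'k) set"
  where "tensor_class V W f =
    module.span scale_pm (tensor_relators V W) +>\<^bsub>free_space (carrier V \<times> carrier W)\<^esub> f"

definition tensor_space ::
  "('k::field, 'v, 'x) module_scheme \<Rightarrow> ('k, 'w, 'y) module_scheme \<Rightarrow>
    ('k, ('v \<times> 'w \<Rightarrow>\<^sub>0 'k) set) module"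
  where "tensor_space V W =
    \<lparr>carrier = tensor_class V W ` carrier (free_space (carrier V \<times> carrier W)),
     mult = undefined, one = undefined,
     zero = tensor_class V W 0,
     add = set_add (free_space (carrier V \<times> carrier W)),
     smult = (\<lambda>c X. the_elem ((\<lambda>f. tensor_class V W (scale_pm c f)) ` X))\<rparr>"

definition pure_tensor ::
  "('k::field, 'v, 'x) module_scheme \<Rightarrow> ('k, 'w, 'y) module_scheme \<Rightarrow>
    'v \<Rightarrow> 'w \<Rightarrow> ('v \<times> 'w \<Rightarrow>\<^sub>0 'k) set"
  where "pure_tensor V W v w = tensor_class V W (Poly_Mapping.single (v, w) 1)"

text \<open>
  For bilinear \<open>\<mu> : A \<times> V \<rightarrow> V\<close> and \<open>\<nu> : B \<times> W \<rightarrow> W\<close>, the bilinear map sending a class \<open>X\<close> in the tensor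
  product of \<open>A\<close> and \<open>B\<close> and a class \<open>Y\<close> in the tensor product of \<open>V\<close> and \<open>W\<close> to a class in the latter,
  given on pure tensors by \<open>(a \<otimes> b, v \<otimes> w) \<mapsto> \<mu> a v \<otimes> \<nu> b w\<close>.  It is computed on representatives.
\<close>

definition tensor_act ::
  "('k::field, 'v, 'x) module_scheme \<Rightarrow> ('k, 'w, 'y) module_scheme \<Rightarrow>
    ('a \<Rightarrow> 'v \<Rightarrow> 'v) \<Rightarrow> ('b \<Rightarrow> 'w \<Rightarrow> 'w) \<Rightarrow>
    ('a \<times> 'b \<Rightarrow>\<^sub>0 'k) set \<Rightarrow> ('v \<times> 'w \<Rightarrow>\<^sub>0 'k) set \<Rightarrow> ('v \<times> 'w \<Rightarrow>\<^sub>0 'k) set"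
  where "tensor_act V W \<mu> \<nu> X Y = the_elem
    {tensor_class V W
       (\<Sum>(a, b)\<in>Poly_Mapping.keys f. \<Sum>(v, w)\<in>Poly_Mapping.keys g.
          Poly_Mapping.single (\<mu> a v, \<nu> b w) (Poly_Mapping.lookup f (a, b) * Poly_Mapping.lookup g (v, w)))
      | f g. f \<in> X \<and> g \<in> Y}"

definition tensor_algebra ::
  "('k::field, 'a, 'x) module_scheme \<Rightarrow> ('k, 'b, 'y) module_scheme \<Rightarrow>
    ('k, ('a \<times> 'b \<Rightarrow>\<^sub>0 'k) set) module"
  where "tensor_algebra A B = (tensor_space A B)
    \<lparr>mult := tensor_act A B (mult A) (mult B), one := pure_tensor A B \<one>\<^bsub>A\<^esub> \<one>\<^bsub>B\<^esub>\<rparr>"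

text \<open>The underlying vector space of a module \<open>M\<close> over a \<open>'k\<close>-algebra \<open>A\<close>.\<close>

definition restrict_scalars ::
  "('k::field, 'a, 'x) module_scheme \<Rightarrow> ('a, 'm, 'y) module_scheme \<Rightarrow> ('k, 'm) module"
  where "restrict_scalars A M =
    \<lparr>carrier = carrier M, mult = undefined, one = undefined, zero = \<zero>\<^bsub>M\<^esub>, add = add M,
     smult = (\<lambda>c x. (c \<odot>\<^bsub>A\<^esub> \<one>\<^bsub>A\<^esub>) \<odot>\<^bsub>M\<^esub> x)\<rparr>"


section \<open>Free associative algebras\<close>

text \<open>
  The free monoid, written additively because the multiplication of \<open>'m \<Rightarrow>\<^sub>0 'k\<close> is the convolution
  product of the monoid algebra of an additive monoid \<open>'m\<close>.  So \<open>'x word \<Rightarrow>\<^sub>0 'k\<close> is the free unital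
  associative \<open>'k\<close>-algebra on \<open>'x\<close>.
\<close>

datatype 'x word = Word (letters: "'x list")

instantiation word :: (type) monoid_add
begin

definition zero_word :: "'x word" where "zero_word = Word []"

definition plus_word :: "'x word \<Rightarrow> 'x word \<Rightarrow> 'x word"
  where "plus_word u v = Word (letters u @ letters v)"

instance
  by standard (simp_all add: zero_word_def plus_word_def)

end

definition free_algebra :: "('k::field, 'x word \<Rightarrow>\<^sub>0 'k) module"
  where "free_algebra =
    \<lparr>carrier = UNIV, mult = (*), one = 1, zero = 0, add = (+), smult = scale_pm\<rparr>"

definition free_gen :: "'x \<Rightarrow> ('x word \<Rightarrow>\<^sub>0 'k::field)"
  where "free_gen x = Poly_Mapping.single (Word [x]) 1"

text \<open>The algebra homomorphism from the free algebra to \<open>A\<close> that extends \<open>\<phi>\<close>.\<close>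

definition free_extend ::
  "('k::field, 'a, 'z) module_scheme \<Rightarrow> ('x \<Rightarrow> 'a) \<Rightarrow> ('x word \<Rightarrow>\<^sub>0 'k) \<Rightarrow> 'a"
  where "free_extend A \<phi> f =
    (\<Oplus>\<^bsub>A\<^esub>w\<in>Poly_Mapping.keys f.
       Poly_Mapping.lookup f w \<odot>\<^bsub>A\<^esub> foldr (\<lambda>x t. \<phi> x \<otimes>\<^bsub>A\<^esub> t) (letters w) \<one>\<^bsub>A\<^esub>)"

text \<open>The algebra homomorphism it induces on a quotient of the free algebra, when it factors.\<close>

definition quot_extend ::
  "('k::field, 'a, 'z) module_scheme \<Rightarrow> ('x \<Rightarrow> 'a) \<Rightarrow> ('x word \<Rightarrow>\<^sub>0 'k) set \<Rightarrow> 'a"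
  where "quot_extend A \<phi> X = the_elem (free_extend A \<phi> ` X)"


section \<open>The Hopf algebra \<open>\<uu>(\<mm>)\<close>\<close>

datatype um_gen = Gen_a | Gen_b | Gen_c

type_synonym 'k um = "(um_gen word \<Rightarrow>\<^sub>0 'k) set"

definition um_relators :: "(um_gen word \<Rightarrow>\<^sub>0 'k::field) set"
  where "um_relators =
    (let a = free_gen Gen_a; b = free_gen Gen_b; c = free_gen Gen_c in
      {a * b + b * a - c, a * c + c * a - a, b * c + c * b - b, a ^ 4, b ^ 4, c ^ 2 + c})"

definition um_ideal :: "(um_gen word \<Rightarrow>\<^sub>0 'k::field) set"
  where "um_ideal = Idl\<^bsub>free_algebra\<^esub> um_relators"

definition um_class :: "(um_gen word \<Rightarrow>\<^sub>0 'k::field) \<Rightarrow> 'k um"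
  where "um_class f = um_ideal +>\<^bsub>free_algebra\<^esub> f"

definition um :: "('k::field, 'k um) module"
  where "um = ring.extend (free_algebra Quot um_ideal)
    (module.fields (\<lambda>c X. um_class (scale_pm c 1) \<otimes>\<^bsub>free_algebra Quot um_ideal\<^esub> X))"

definition um_gen_elem :: "um_gen \<Rightarrow> 'k::field um"
  where "um_gen_elem x = um_class (free_gen x)"

definition um_comult :: "'k::field um \<Rightarrow> ('k um \<times> 'k um \<Rightarrow>\<^sub>0 'k) set"
  where "um_comult = quot_extend (tensor_algebra um um)
    (\<lambda>x. pure_tensor um um (um_gen_elem x) \<one>\<^bsub>um\<^esub>
         \<oplus>\<^bsub>tensor_algebra um um\<^esub> pure_tensor um um \<one>\<^bsub>um\<^esub> (um_gen_elem x))"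

definition field_algebra :: "('k::field, 'k) module"
  where "field_algebra =
    \<lparr>carrier = UNIV, mult = (*), one = 1, zero = 0, add = (+), smult = (*)\<rparr>"

definition um_counit :: "'k::field um \<Rightarrow> 'k"
  where "um_counit = quot_extend field_algebra (\<lambda>x. 0)"

definition um_tensor ::
  "('k::field um, 'v, 'x) module_scheme \<Rightarrow> ('k um, 'w, 'y) module_scheme \<Rightarrow>
    ('k um, ('v \<times> 'w \<Rightarrow>\<^sub>0 'k) set) module"
  where "um_tensor V W =
    (let V' = restrict_scalars um V; W' = restrict_scalars um W; T = tensor_space V' W' in
      \<lparr>carrier = carrier T, mult = undefined, one = undefined, zero = \<zero>\<^bsub>T\<^esub>, add = add T,
       smult = (\<lambda>u. tensor_act V' W' (smult V) (smult W) (um_comult u))\<rparr>)"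


section \<open>The modules \<open>V\<^sub>0\<close> and \<open>V\<^sub>1\<close>\<close>

definition V0 :: "('k::field um, 'k) module"
  where "V0 =
    \<lparr>carrier = UNIV, mult = undefined, one = undefined, zero = 0, add = (+),
     smult = (\<lambda>u t. um_counit u * t)\<rparr>"

definition matrix_algebra :: "('k::field, 'k ^ 'n::finite ^ 'n) module"
  where "matrix_algebra =
    \<lparr>carrier = UNIV, mult = (**), one = mat 1, zero = 0, add = (+),
     smult = (\<lambda>c A. \<chi> i j. c * A $ i $ j)\<rparr>"

text \<open>
  The matrices of \<open>a\<close>, \<open>b\<close>, \<open>c\<close> on \<open>V\<^sub>1\<close> in the basis \<open>v\<^sub>1, v\<^sub>2, v\<^sub>3\<close>, acting on column vectors, so
  that \<open>v\<^sub>i\<close> is \<open>axis i 1\<close>.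
\<close>

fun V1_matrix :: "um_gen \<Rightarrow> 'k::field ^ 3 ^ 3"
  where
    "V1_matrix Gen_a = vector [vector [0, 0, 0], vector [1, 0, 0], vector [0, 1, 0]]"
  | "V1_matrix Gen_b = vector [vector [0, 1, 0], vector [0, 0, 1], vector [0, 0, 0]]"
  | "V1_matrix Gen_c = vector [vector [1, 0, 0], vector [0, 0, 0], vector [0, 0, 1]]"

definition V1 :: "('k::field um, 'k ^ 3) module"
  where "V1 =
    \<lparr>carrier = UNIV, mult = undefined, one = undefined, zero = 0, add = (+),
     smult = (\<lambda>u v. quot_extend matrix_algebra V1_matrix u *v v)\<rparr>"

end

theory Submission
  imports Defs
begin

text \<open>
  Let \<open>\<pi> : P\<^sub>1 \<rightarrow> V\<^sub>1\<close> be the covering map, choose \<open>x\<close> with \<open>\<pi> x = v\<^sub>3\<close> and put \<open>y = a\<^sup>2 b\<^sup>2 c x\<close>.  Then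
  \<open>\<pi> y = v\<^sub>3\<close>, \<open>c y = y\<close> and \<open>a\<^sup>2 y = 0\<close>, so the eight elements \<open>b\<^sup>i y\<close>, \<open>b\<^sup>i a y\<close> with \<open>i < 4\<close> span
  a submodule on which the action is explicit.  This gives a homomorphism \<open>S : V\<^sub>1 \<otimes> V\<^sub>1 \<rightarrow> P\<^sub>1\<close> with
  \<open>\<pi> S\<close> onto, and \<open>S\<close> is onto because the kernel of \<open>\<pi>\<close> is superfluous.  As \<open>P\<^sub>1\<close> is projective, \<open>S\<close>
  has a section \<open>h\<close>.  The conditions on \<open>h y\<close> leave only \<open>h y = \<alpha> v\<^sub>2 \<otimes> v\<^sub>3 + \<beta> v\<^sub>3 \<otimes> v\<^sub>2\<close> with
  \<open>\<alpha> + \<beta> = 1\<close>, and the eight elements \<open>b\<^sup>i h y\<close>, \<open>b\<^sup>i a h y\<close> are then linearly independent.  Hence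
  the kernel of \<open>S\<close> is the line spanned by \<open>v\<^sub>1 \<otimes> v\<^sub>3 + v\<^sub>2 \<otimes> v\<^sub>2 + v\<^sub>3 \<otimes> v\<^sub>1\<close>, on which the invariant
  form \<open>m \<mapsto> m\<^sub>1\<^sub>3 + m\<^sub>2\<^sub>2 + m\<^sub>3\<^sub>1\<close> does not vanish.
\<close>

section \<open>Formal linear combinations\<close>

text \<open>There the eight elements serve only for rewriting; equations between their coefficients
  are read off after applying h, among 3 by 3 matrices. As h y is known only up to \<alpha>, that
  computation has to work for all \<alpha>, \<beta> with sum 1.

  The formula for S (\<open>matrix_lc\<close>) is found backwards. Take v2 \<otimes> v3 as the model
  for y: the eight elements built on it fill the kernel of the invariant form, and solving for their
  coefficients in terms of the matrix entries gives S on this kernel. There m22 = m13 + m31, so the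
  coefficient of b y can be written m13 + m31 and that of b^2 a y can be written m13 + m22. In this
  form all coefficients vanish on v1 \<otimes> v3 + v2 \<otimes> v2 + v3 \<otimes> v1 as well. The
  form takes the value 1 + 1 + 1 = 1 on that vector, which is why its line splits off.\<close>

lemma lookup_scale_pm [simp]: "Poly_Mapping.lookup (scale_pm c f) x = c * Poly_Mapping.lookup f x"
  by (simp add: scale_pm_def Poly_Mapping.map.rep_eq when_def)

lemma scale_pm_single [simp]: "scale_pm c (Poly_Mapping.single x d) = Poly_Mapping.single x (c * d)"
  by (rule poly_mapping_eqI) (simp add: lookup_single when_def)

interpretation pm: vector_space scale_pm
  by unfold_locales
    (auto intro!: poly_mapping_eqI simp: lookup_add algebra_simps)

lemma keys_scale_pm: "Poly_Mapping.keys (scale_pm c f) \<subseteq> Poly_Mapping.keys f"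
  by (auto simp: in_keys_iff)

lemma keys_add_subset:
  "\<lbrakk>Poly_Mapping.keys f \<subseteq> S; Poly_Mapping.keys g \<subseteq> S\<rbrakk> \<Longrightarrow> Poly_Mapping.keys (f + g) \<subseteq> S"
  using Poly_Mapping.keys_add [of f g] by blast

lemma keys_scale_subset: "Poly_Mapping.keys f \<subseteq> S \<Longrightarrow> Poly_Mapping.keys (scale_pm c f) \<subseteq> S"
  using keys_scale_pm [of c f] by blast

lemma poly_mapping_as_sum:
  "f = (\<Sum>x\<in>Poly_Mapping.keys f. Poly_Mapping.single x (Poly_Mapping.lookup f x))"
  by (rule poly_mapping_eqI)
    (auto simp: lookup_sum lookup_single when_def in_keys_iff sum.delta)

text \<open>Addition and scaling are separate cases, so a claim linear in \<open>f\<close> is closed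
  by its linearity rules and only basis elements remain. Nested uses treat bilinear and trilinear
  claims in the same way.\<close>

lemma pm_induct [consumes 1, case_names zero add scale single]:
  assumes "Poly_Mapping.keys f \<subseteq> S"
    and "P 0" and add: "\<And>f g. P f \<Longrightarrow> P g \<Longrightarrow> P (f + g)"
    and scale: "\<And>c f. P f \<Longrightarrow> P (scale_pm c f)"
    and single: "\<And>x. x \<in> S \<Longrightarrow> P (Poly_Mapping.single x 1)"
  shows "P f"
proof -
  have "P (\<Sum>x\<in>X. Poly_Mapping.single x (Poly_Mapping.lookup f x))"
    if "finite X" "X \<subseteq> S" for X
    using that
  proof (induction X)
    case (insert x X)
    have "P (scale_pm (Poly_Mapping.lookup f x) (Poly_Mapping.single x 1))"
      using insert.prems by (intro scale single) auto
    then show ?case using insert by (simp add: add)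
  qed (simp add: assms(2))
  then show ?thesis
    using assms(1) by (metis poly_mapping_as_sum finite_keys)
qed

definition lin_extend :: "('s \<Rightarrow> 't \<Rightarrow>\<^sub>0 'k::field) \<Rightarrow> ('s \<Rightarrow>\<^sub>0 'k) \<Rightarrow> 't \<Rightarrow>\<^sub>0 'k"
  where "lin_extend \<phi> f = (\<Sum>x\<in>Poly_Mapping.keys f. scale_pm (Poly_Mapping.lookup f x) (\<phi> x))"

text \<open>Cancellation can shrink the set of keys of a sum, so additivity is checked over a common
  finite set containing all keys involved.\<close>

lemma lin_extend_superset:
  assumes "finite X" "Poly_Mapping.keys f \<subseteq> X"
  shows "lin_extend \<phi> f = (\<Sum>x\<in>X. scale_pm (Poly_Mapping.lookup f x) (\<phi> x))"
  unfolding lin_extend_def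
  by (rule sum.mono_neutral_left) (use assms in \<open>auto simp: in_keys_iff\<close>)

lemma lin_extend_0 [simp]: "lin_extend \<phi> 0 = 0"
  by (simp add: lin_extend_def)

lemma lin_extend_single [simp]: "lin_extend \<phi> (Poly_Mapping.single x c) = scale_pm c (\<phi> x)"
  by (simp add: lin_extend_def)

lemma lin_extend_add: "lin_extend \<phi> (f + g) = lin_extend \<phi> f + lin_extend \<phi> g"
proof -
  let ?X = "Poly_Mapping.keys f \<union> Poly_Mapping.keys g"
  show ?thesis
    using lin_extend_superset [of ?X f \<phi>] lin_extend_superset [of ?X g \<phi>]
      lin_extend_superset [of ?X "f + g" \<phi>] Poly_Mapping.keys_add [of f g]
    by (simp add: lookup_add pm.scale_left_distrib sum.distrib)
qed

lemma lin_extend_scale: "lin_extend \<phi> (scale_pm c f) = scale_pm c (lin_extend \<phi> f)"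
  using lin_extend_superset [of "Poly_Mapping.keys f" "scale_pm c f" \<phi>] keys_scale_pm [of c f]
  by (simp add: lin_extend_def pm.scale_sum_right)

lemma lin_extend_diff: "lin_extend \<phi> (f - g) = lin_extend \<phi> f - lin_extend \<phi> g"
  using lin_extend_add [of \<phi> "f - g" g] by simp

lemma lin_extend_fun_add: "lin_extend (\<lambda>x. \<phi> x + \<psi> x) f = lin_extend \<phi> f + lin_extend \<psi> f"
  by (simp add: lin_extend_def pm.scale_right_distrib sum.distrib)

lemma lin_extend_fun_scale: "lin_extend (\<lambda>x. scale_pm c (\<phi> x)) f = scale_pm c (lin_extend \<phi> f)"
  by (simp add: lin_extend_def pm.scale_sum_right mult.commute)

text \<open>The double sum inside \<open>tensor_act\<close>, before classes are taken. Written as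
  two nested linear extensions it inherits bilinearity from \<open>lin_extend\<close>;
  \<open>tensor_rep_eq\<close> recovers the sum.\<close>

definition tensor_rep ::
  "('a \<Rightarrow> 'v \<Rightarrow> 'v') \<Rightarrow> ('b \<Rightarrow> 'w \<Rightarrow> 'w') \<Rightarrow> ('a \<times> 'b \<Rightarrow>\<^sub>0 'k::field) \<Rightarrow> ('v \<times> 'w \<Rightarrow>\<^sub>0 'k) \<Rightarrow> ('v' \<times> 'w' \<Rightarrow>\<^sub>0 'k)"
  where "tensor_rep \<mu> \<nu> f g =
    lin_extend (\<lambda>(a, b). lin_extend (\<lambda>(v, w). Poly_Mapping.single (\<mu> a v, \<nu> b w) 1) g) f"

lemma tensor_rep_eq:
  "tensor_rep \<mu> \<nu> f g =
    (\<Sum>(a, b)\<in>Poly_Mapping.keys f. \<Sum>(v, w)\<in>Poly_Mapping.keys g.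
       Poly_Mapping.single (\<mu> a v, \<nu> b w) (Poly_Mapping.lookup f (a, b) * Poly_Mapping.lookup g (v, w)))"
  by (auto simp: tensor_rep_def lin_extend_def pm.scale_sum_right intro!: sum.cong)

lemma tensor_rep_add_left: "tensor_rep \<mu> \<nu> (f + f') g = tensor_rep \<mu> \<nu> f g + tensor_rep \<mu> \<nu> f' g"
  by (simp add: tensor_rep_def lin_extend_add)

lemma tensor_rep_diff_left: "tensor_rep \<mu> \<nu> (f - f') g = tensor_rep \<mu> \<nu> f g - tensor_rep \<mu> \<nu> f' g"
  by (simp add: tensor_rep_def lin_extend_diff)

lemma tensor_rep_scale_left: "tensor_rep \<mu> \<nu> (scale_pm c f) g = scale_pm c (tensor_rep \<mu> \<nu> f g)"
  by (simp add: tensor_rep_def lin_extend_scale)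

lemma tensor_rep_add_right: "tensor_rep \<mu> \<nu> f (g + g') = tensor_rep \<mu> \<nu> f g + tensor_rep \<mu> \<nu> f g'"
  by (simp add: tensor_rep_def lin_extend_add case_prod_unfold lin_extend_fun_add)

lemma tensor_rep_scale_right: "tensor_rep \<mu> \<nu> f (scale_pm c g) = scale_pm c (tensor_rep \<mu> \<nu> f g)"
  by (simp add: tensor_rep_def lin_extend_scale case_prod_unfold lin_extend_fun_scale)

lemma tensor_rep_diff_right: "tensor_rep \<mu> \<nu> f (g - g') = tensor_rep \<mu> \<nu> f g - tensor_rep \<mu> \<nu> f g'"
  using tensor_rep_add_right [of \<mu> \<nu> f "g - g'" g'] by simp

lemma tensor_rep_single [simp]:
  "tensor_rep \<mu> \<nu> (Poly_Mapping.single (a, b) c) (Poly_Mapping.single (v, w) d) =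
    Poly_Mapping.single (\<mu> a v, \<nu> b w) (c * d)"
  by (simp add: tensor_rep_def)

lemma tensor_rep_0 [simp]: "tensor_rep \<mu> \<nu> 0 g = 0" "tensor_rep \<mu> \<nu> f 0 = 0"
  using tensor_rep_scale_right [of \<mu> \<nu> f 0 0] by (simp_all add: tensor_rep_def)

lemmas tensor_rep_linear = tensor_rep_add_left tensor_rep_diff_left tensor_rep_scale_left
  tensor_rep_add_right tensor_rep_diff_right tensor_rep_scale_right

section \<open>Tensor products\<close>

lemma tensor_class_iff:
  "f \<in> tensor_class V W g \<longleftrightarrow> f - g \<in> pm.span (tensor_relators V W)"
  by (force simp: tensor_class_def a_r_coset_defs free_space_def)

lemma tensor_class_self [simp]: "f \<in> tensor_class V W f"
  by (simp add: tensor_class_iff pm.span_zero)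

lemma tensor_class_eq_iff:
  "tensor_class V W f = tensor_class V W g \<longleftrightarrow> f - g \<in> pm.span (tensor_relators V W)"
proof
  assume "f - g \<in> pm.span (tensor_relators V W)"
  then have "h - f \<in> pm.span (tensor_relators V W) \<longleftrightarrow> h - g \<in> pm.span (tensor_relators V W)" for h
    using pm.span_diff [of "h - g" _ "f - g"] pm.span_add [of "h - f" _ "f - g"] by auto
  then show "tensor_class V W f = tensor_class V W g"
    by (auto simp: tensor_class_iff)
qed (metis tensor_class_iff tensor_class_self)

lemma tensor_carrier:
  "carrier (tensor_space V W) =
    tensor_class V W ` {f. Poly_Mapping.keys f \<subseteq> carrier V \<times> carrier W}"
  by (simp add: tensor_space_def free_space_def)

lemma tensor_zero: "\<zero>\<^bsub>tensor_space V W\<^esub> = tensor_class V W 0"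
  by (simp add: tensor_space_def)

lemma tensor_add:
  "tensor_class V W f \<oplus>\<^bsub>tensor_space V W\<^esub> tensor_class V W g = tensor_class V W (f + g)"
proof -
  have "\<exists>p q. p \<in> tensor_class V W f \<and> q \<in> tensor_class V W g \<and> h = p + q"
    if "h \<in> tensor_class V W (f + g)" for h
    using that by (intro exI [of _ "h - g"] exI [of _ g]) (auto simp: tensor_class_iff algebra_simps)
  moreover have "p + q \<in> tensor_class V W (f + g)"
    if "p \<in> tensor_class V W f" "q \<in> tensor_class V W g" for p q
    using that pm.span_add [of "p - f" _ "q - g"] by (auto simp: tensor_class_iff algebra_simps)
  ultimately show ?thesis
    by (force simp: tensor_space_def set_add_defs free_space_def)
qed

lemma tensor_smult:
  "c \<odot>\<^bsub>tensor_space V W\<^esub> tensor_class V W g = tensor_class V W (scale_pm c g)"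
proof -
  have "tensor_class V W (scale_pm c f) = tensor_class V W (scale_pm c g)"
    if "f \<in> tensor_class V W g" for f
    using that pm.span_scale [of "f - g" _ c]
    by (simp add: tensor_class_iff tensor_class_eq_iff pm.scale_right_diff_distrib)
  then have "(\<lambda>f. tensor_class V W (scale_pm c f)) ` tensor_class V W g = {tensor_class V W (scale_pm c g)}"
    using tensor_class_self [of g V W] by blast
  then show ?thesis by (simp add: tensor_space_def)
qed

section \<open>Vector spaces whose scalars form a type\<close>

locale vspace = abelian_group V for V :: "('k::field, 'v, 'x) module_scheme" (structure) +
  assumes scale_closed [simp]: "x \<in> carrier V \<Longrightarrow> c \<odot> x \<in> carrier V"
    and scale_l_distr: "x \<in> carrier V \<Longrightarrow> (c + d) \<odot> x = c \<odot> x \<oplus> d \<odot> x"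
    and scale_r_distr: "\<lbrakk>x \<in> carrier V; y \<in> carrier V\<rbrakk> \<Longrightarrow> c \<odot> (x \<oplus> y) = c \<odot> x \<oplus> c \<odot> y"
    and scale_assoc: "x \<in> carrier V \<Longrightarrow> (c * d) \<odot> x = c \<odot> (d \<odot> x)"
    and scale_one [simp]: "x \<in> carrier V \<Longrightarrow> 1 \<odot> x = x"
begin

lemma scale_zero_left [simp]: "x \<in> carrier V \<Longrightarrow> 0 \<odot> x = \<zero>"
  using scale_l_distr [of x 0 0] scale_closed [of x 0] by simp

lemma scale_zero_right [simp]: "c \<odot> \<zero> = \<zero>"
  using scale_r_distr [of \<zero> \<zero> c] scale_closed [of \<zero> c] by simp

end

text \<open>The inverse of \<open>x\<close> is -1 times \<open>x\<close>, so the law that 0 times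
  \<open>x\<close> is zero replaces the existence of additive inverses.\<close>

lemma vspaceI:
  fixes V :: "('k::field, 'v, 'x) module_scheme"
  assumes "\<And>x y. \<lbrakk>x \<in> carrier V; y \<in> carrier V\<rbrakk> \<Longrightarrow> x \<oplus>\<^bsub>V\<^esub> y \<in> carrier V"
    and zero: "\<zero>\<^bsub>V\<^esub> \<in> carrier V"
    and "\<And>x y z. \<lbrakk>x \<in> carrier V; y \<in> carrier V; z \<in> carrier V\<rbrakk> \<Longrightarrow>
      (x \<oplus>\<^bsub>V\<^esub> y) \<oplus>\<^bsub>V\<^esub> z = x \<oplus>\<^bsub>V\<^esub> (y \<oplus>\<^bsub>V\<^esub> z)"
    and comm: "\<And>x y. \<lbrakk>x \<in> carrier V; y \<in> carrier V\<rbrakk> \<Longrightarrow> x \<oplus>\<^bsub>V\<^esub> y = y \<oplus>\<^bsub>V\<^esub> x"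
    and l_zero: "\<And>x. x \<in> carrier V \<Longrightarrow> \<zero>\<^bsub>V\<^esub> \<oplus>\<^bsub>V\<^esub> x = x"
    and sc: "\<And>c x. x \<in> carrier V \<Longrightarrow> c \<odot>\<^bsub>V\<^esub> x \<in> carrier V"
    and sl: "\<And>c d x. x \<in> carrier V \<Longrightarrow> (c + d) \<odot>\<^bsub>V\<^esub> x = c \<odot>\<^bsub>V\<^esub> x \<oplus>\<^bsub>V\<^esub> d \<odot>\<^bsub>V\<^esub> x"
    and "\<And>c x y. \<lbrakk>x \<in> carrier V; y \<in> carrier V\<rbrakk> \<Longrightarrow>
      c \<odot>\<^bsub>V\<^esub> (x \<oplus>\<^bsub>V\<^esub> y) = c \<odot>\<^bsub>V\<^esub> x \<oplus>\<^bsub>V\<^esub> c \<odot>\<^bsub>V\<^esub> y"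
    and "\<And>c d x. x \<in> carrier V \<Longrightarrow> (c * d) \<odot>\<^bsub>V\<^esub> x = c \<odot>\<^bsub>V\<^esub> (d \<odot>\<^bsub>V\<^esub> x)"
    and s1: "\<And>x. x \<in> carrier V \<Longrightarrow> 1 \<odot>\<^bsub>V\<^esub> x = x"
    and s0: "\<And>x. x \<in> carrier V \<Longrightarrow> 0 \<odot>\<^bsub>V\<^esub> x = \<zero>\<^bsub>V\<^esub>"
  shows "vspace V"
proof -
  have inv: "\<exists>y\<in>carrier V. y \<oplus>\<^bsub>V\<^esub> x = \<zero>\<^bsub>V\<^esub>" if "x \<in> carrier V" for x
    using that sl [of x "-1" 1] by (intro bexI [of _ "(-1) \<odot>\<^bsub>V\<^esub> x"]) (simp_all add: sc s1 s0)
  interpret abelian_group V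
    by (rule abelian_groupI) (use assms inv in auto)
  show ?thesis by unfold_locales (use assms in auto)
qed

lemma vspace_tensor: "vspace (tensor_space V W)"
  by (rule vspaceI)
    (auto simp: tensor_carrier tensor_zero tensor_add tensor_smult algebra_simps
      dest!: subsetD [OF Poly_Mapping.keys_add]
      subsetD [OF keys_scale_pm] intro!: imageI)

section \<open>Bilinear maps acting on tensor classes\<close>

definition bilinear_map ::
  "('k::field, 'a, 'x) module_scheme \<Rightarrow> ('k, 'v, 'y) module_scheme \<Rightarrow> ('k, 'w, 'z) module_scheme \<Rightarrow>
    ('a \<Rightarrow> 'v \<Rightarrow> 'w) \<Rightarrow> bool"
  where "bilinear_map A V W \<mu> \<longleftrightarrow>
    (\<forall>a\<in>carrier A. \<forall>v\<in>carrier V. \<mu> a v \<in> carrier W) \<and>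
    (\<forall>a\<in>carrier A. \<forall>a'\<in>carrier A. \<forall>v\<in>carrier V. \<mu> (a \<oplus>\<^bsub>A\<^esub> a') v = \<mu> a v \<oplus>\<^bsub>W\<^esub> \<mu> a' v) \<and>
    (\<forall>a\<in>carrier A. \<forall>v\<in>carrier V. \<forall>v'\<in>carrier V. \<mu> a (v \<oplus>\<^bsub>V\<^esub> v') = \<mu> a v \<oplus>\<^bsub>W\<^esub> \<mu> a v') \<and>
    (\<forall>c. \<forall>a\<in>carrier A. \<forall>v\<in>carrier V. \<mu> (c \<odot>\<^bsub>A\<^esub> a) v = c \<odot>\<^bsub>W\<^esub> \<mu> a v \<and> \<mu> a (c \<odot>\<^bsub>V\<^esub> v) = c \<odot>\<^bsub>W\<^esub> \<mu> a v)"

lemma tensor_relators_memI: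
  fixes V :: "('k::field, 'v, 'x) module_scheme" and W :: "('k, 'w, 'y) module_scheme"
  shows
  "\<lbrakk>v \<in> carrier V; v' \<in> carrier V; w \<in> carrier W\<rbrakk> \<Longrightarrow>
    Poly_Mapping.single (v \<oplus>\<^bsub>V\<^esub> v', w) 1 - Poly_Mapping.single (v, w) 1 - Poly_Mapping.single (v', w) 1
      \<in> pm.span (tensor_relators V W)"
  "\<lbrakk>v \<in> carrier V; w \<in> carrier W; w' \<in> carrier W\<rbrakk> \<Longrightarrow>
    Poly_Mapping.single (v, w \<oplus>\<^bsub>W\<^esub> w') 1 - Poly_Mapping.single (v, w) 1 - Poly_Mapping.single (v, w') 1
      \<in> pm.span (tensor_relators V W)"
  "\<lbrakk>v \<in> carrier V; w \<in> carrier W\<rbrakk> \<Longrightarrow>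
    Poly_Mapping.single (c \<odot>\<^bsub>V\<^esub> v, w) 1 - Poly_Mapping.single (v, w) c \<in> pm.span (tensor_relators V W)"
  "\<lbrakk>v \<in> carrier V; w \<in> carrier W\<rbrakk> \<Longrightarrow>
    Poly_Mapping.single (v, c \<odot>\<^bsub>W\<^esub> w) 1 - Poly_Mapping.single (v, w) c \<in> pm.span (tensor_relators V W)"
  by (rule pm.span_base; unfold tensor_relators_def; blast)+

lemma tensor_relators_cases:
  assumes "n \<in> tensor_relators V W"
  obtains
    (add_left) v v' w where "v \<in> carrier V" "v' \<in> carrier V" "w \<in> carrier W"
      "n = Poly_Mapping.single (v \<oplus>\<^bsub>V\<^esub> v', w) 1 - Poly_Mapping.single (v, w) 1 - Poly_Mapping.single (v', w) 1"
  | (add_right) v w w' where "v \<in> carrier V" "w \<in> carrier W" "w' \<in> carrier W"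
      "n = Poly_Mapping.single (v, w \<oplus>\<^bsub>W\<^esub> w') 1 - Poly_Mapping.single (v, w) 1 - Poly_Mapping.single (v, w') 1"
  | (scale_left) c v w where "v \<in> carrier V" "w \<in> carrier W"
      "n = Poly_Mapping.single (c \<odot>\<^bsub>V\<^esub> v, w) 1 - Poly_Mapping.single (v, w) c"
  | (scale_right) c v w where "v \<in> carrier V" "w \<in> carrier W"
      "n = Poly_Mapping.single (v, c \<odot>\<^bsub>W\<^esub> w) 1 - Poly_Mapping.single (v, w) c"
  using assms unfolding tensor_relators_def by blast

text \<open>Relators only involve pairs from the carriers. So all representatives of a class are
  supported there as soon as one is, and the bilinearity hypotheses apply to whichever
  representatives \<open>tensor_act\<close> uses.\<close>

lemma span_tensor_relators_keys:
  assumes V: "vspace V" and W: "vspace W" and "n \<in> pm.span (tensor_relators V W)"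
  shows "Poly_Mapping.keys n \<subseteq> carrier V \<times> carrier W"
  using assms(3)
proof (induction rule: pm.span_induct_alt)
  case (step c x y)
  interpret V: vspace V by (rule V)
  interpret W: vspace W by (rule W)
  have x: "Poly_Mapping.keys x \<subseteq> carrier V \<times> carrier W"
    using step.hyps(1)
    by (cases rule: tensor_relators_cases)
      (auto dest!: subsetD [OF keys_diff] split: if_splits)
  show ?case
    using Poly_Mapping.keys_add [of "scale_pm c x" y] keys_scale_pm [of c x] x step.IH by blast
qed simp

lemma keys_tensor_rep:
  assumes \<mu>: "bilinear_map A V V' \<mu>" and \<nu>: "bilinear_map B W W' \<nu>"
    and f: "Poly_Mapping.keys f \<subseteq> carrier A \<times> carrier B"
    and g: "Poly_Mapping.keys g \<subseteq> carrier V \<times> carrier W"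
  shows "Poly_Mapping.keys (tensor_rep \<mu> \<nu> f g) \<subseteq> carrier V' \<times> carrier W'"
  using f
proof (induction rule: pm_induct)
  case (single x)
  show ?case
    using g
  proof (induction rule: pm_induct)
    case (single y)
    then show ?case
      using \<open>x \<in> carrier A \<times> carrier B\<close> \<mu> \<nu>
      by (cases x; cases y) (auto simp: bilinear_map_def)
  qed (simp_all add: tensor_rep_linear keys_add_subset keys_scale_subset)
qed (simp_all add: tensor_rep_linear keys_add_subset keys_scale_subset)

text \<open>Half of the well-definedness of the action. Against a single pair \<open>(v, w)\<close>,
  bilinearity of \<mu> and \<nu> turns each relator into a relator of the same kind; the general
  case is a linear combination of these.\<close>

lemma tensor_rep_span_left:
  assumes \<mu>: "bilinear_map A V V' \<mu>" and \<nu>: "bilinear_map B W W' \<nu>"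
    and f: "f \<in> pm.span (tensor_relators A B)"
    and g: "Poly_Mapping.keys g \<subseteq> carrier V \<times> carrier W"
  shows "tensor_rep \<mu> \<nu> f g \<in> pm.span (tensor_relators V' W')"
  using g
proof (induction rule: pm_induct)
  case (single y)
  obtain v w where [simp]: "y = (v, w)" by (cases y)
  show ?case
    using f
  proof (induction rule: pm.span_induct_alt)
    case (step c n h)
    have "tensor_rep \<mu> \<nu> n (Poly_Mapping.single y 1) \<in> pm.span (tensor_relators V' W')"
      using step(1)
      by (cases rule: tensor_relators_cases)
        (use single \<mu> \<nu> in \<open>auto simp: tensor_rep_linear bilinear_map_def intro: tensor_relators_memI\<close>)
    then show ?case
      using step by (simp add: tensor_rep_linear pm.span_add pm.span_scale)
  qed (simp add: pm.span_zero)
qed (simp_all add: tensor_rep_linear pm.span_zero pm.span_add pm.span_scale)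

lemma tensor_rep_span_right:
  assumes \<mu>: "bilinear_map A V V' \<mu>" and \<nu>: "bilinear_map B W W' \<nu>"
    and f: "Poly_Mapping.keys f \<subseteq> carrier A \<times> carrier B"
    and g: "g \<in> pm.span (tensor_relators V W)"
  shows "tensor_rep \<mu> \<nu> f g \<in> pm.span (tensor_relators V' W')"
  using f
proof (induction rule: pm_induct)
  case (single x)
  obtain a b where [simp]: "x = (a, b)" by (cases x)
  show ?case
    using g
  proof (induction rule: pm.span_induct_alt)
    case (step c n h)
    have "tensor_rep \<mu> \<nu> (Poly_Mapping.single x 1) n \<in> pm.span (tensor_relators V' W')"
      using step(1)
      by (cases rule: tensor_relators_cases)
        (use single \<mu> \<nu> in \<open>auto simp: tensor_rep_linear bilinear_map_def intro: tensor_relators_memI\<close>)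
    then show ?case
      using step by (simp add: tensor_rep_linear pm.span_add pm.span_scale)
  qed (simp add: pm.span_zero)
qed (simp_all add: tensor_rep_linear pm.span_zero pm.span_add pm.span_scale)

text \<open>Replacing \<open>f\<close> by \<open>f'\<close> and \<open>g\<close> by
  \<open>g'\<close> changes the value by the action of \<open>f' - f\<close> on \<open>g'\<close>
  plus that of \<open>f\<close> on \<open>g' - g\<close>. Each of the two terms lies in the span of
  the relators, so \<open>the_elem\<close> is applied to a singleton.\<close>

lemma tensor_act_class:
  assumes A: "vspace A" and B: "vspace B" and V: "vspace V" and W: "vspace W"
    and \<mu>: "bilinear_map A V V \<mu>" and \<nu>: "bilinear_map B W W \<nu>"
    and f: "Poly_Mapping.keys f \<subseteq> carrier A \<times> carrier B"
    and g: "Poly_Mapping.keys g \<subseteq> carrier V \<times> carrier W"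
  shows "tensor_act V W \<mu> \<nu> (tensor_class A B f) (tensor_class V W g) =
    tensor_class V W (tensor_rep \<mu> \<nu> f g)"
proof -
  have "tensor_class V W (tensor_rep \<mu> \<nu> f' g') = tensor_class V W (tensor_rep \<mu> \<nu> f g)"
    if f': "f' \<in> tensor_class A B f" and g': "g' \<in> tensor_class V W g" for f' g'
  proof -
    have df: "f' - f \<in> pm.span (tensor_relators A B)" and dg: "g' - g \<in> pm.span (tensor_relators V W)"
      using f' g' by (simp_all add: tensor_class_iff)
    have "Poly_Mapping.keys g' \<subseteq> carrier V \<times> carrier W"
      using Poly_Mapping.keys_add [of "g' - g" g] span_tensor_relators_keys [OF V W dg] g by auto
    from tensor_rep_span_left [OF \<mu> \<nu> df this] tensor_rep_span_right [OF \<mu> \<nu> f dg]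
    have "tensor_rep \<mu> \<nu> (f' - f) g' + tensor_rep \<mu> \<nu> f (g' - g) \<in> pm.span (tensor_relators V W)"
      by (rule pm.span_add)
    then show ?thesis
      by (simp add: tensor_class_eq_iff tensor_rep_linear)
  qed
  then have "{tensor_class V W (tensor_rep \<mu> \<nu> f' g') | f' g'.
      f' \<in> tensor_class A B f \<and> g' \<in> tensor_class V W g} = {tensor_class V W (tensor_rep \<mu> \<nu> f g)}"
    using tensor_class_self [of f A B] tensor_class_self [of g V W] by blast
  then show ?thesis
    by (simp add: tensor_act_def tensor_rep_eq)
qed

text \<open>Both sides are trilinear, which leaves pairs. With primed and unprimed maps equal this
  is associativity of the tensor product algebra; with module actions as the primed maps it is the
  associativity law for \<open>um_tensor\<close>.\<close>

lemma tensor_rep_assoc: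
  assumes "\<And>a a' v. \<lbrakk>a \<in> carrier A; a' \<in> carrier A; v \<in> carrier V\<rbrakk> \<Longrightarrow> \<mu>' (\<mu> a a') v = \<mu>' a (\<mu>' a' v)"
    and "\<And>b b' w. \<lbrakk>b \<in> carrier B; b' \<in> carrier B; w \<in> carrier W\<rbrakk> \<Longrightarrow> \<nu>' (\<nu> b b') w = \<nu>' b (\<nu>' b' w)"
    and f: "Poly_Mapping.keys f \<subseteq> carrier A \<times> carrier B"
    and f': "Poly_Mapping.keys f' \<subseteq> carrier A \<times> carrier B"
    and g: "Poly_Mapping.keys g \<subseteq> carrier V \<times> carrier W"
  shows "tensor_rep \<mu>' \<nu>' (tensor_rep \<mu> \<nu> f f') g = tensor_rep \<mu>' \<nu>' f (tensor_rep \<mu>' \<nu>' f' g)"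
  using f
proof (induction rule: pm_induct)
  case (single x)
  show ?case
    using f'
  proof (induction rule: pm_induct)
    case (single x')
    show ?case
      using g
    proof (induction rule: pm_induct)
      case (single y)
      then show ?case
        using assms(1,2) \<open>x \<in> _\<close> \<open>x' \<in> _\<close> by (cases x; cases x'; cases y) auto
    qed (simp_all add: tensor_rep_linear)
  qed (simp_all add: tensor_rep_linear)
qed (simp_all add: tensor_rep_linear)

section \<open>Algebras over a field\<close>

locale k_algebra = ring A + vspace A for A :: "('k::field, 'a, 'x) module_scheme" (structure) +
  assumes scale_mult_left: "\<lbrakk>x \<in> carrier A; y \<in> carrier A\<rbrakk> \<Longrightarrow> (c \<odot> x) \<otimes> y = c \<odot> (x \<otimes> y)"
    and scale_mult_right: "\<lbrakk>x \<in> carrier A; y \<in> carrier A\<rbrakk> \<Longrightarrow> x \<otimes> (c \<odot> y) = c \<odot> (x \<otimes> y)"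

lemma k_algebraI:
  fixes A :: "('k::field, 'a, 'x) module_scheme" (structure)
  assumes "vspace A"
    and "\<And>x y. \<lbrakk>x \<in> carrier A; y \<in> carrier A\<rbrakk> \<Longrightarrow> x \<otimes> y \<in> carrier A"
    and "\<one> \<in> carrier A"
    and "\<And>x y z. \<lbrakk>x \<in> carrier A; y \<in> carrier A; z \<in> carrier A\<rbrakk> \<Longrightarrow> (x \<otimes> y) \<otimes> z = x \<otimes> (y \<otimes> z)"
    and "\<And>x. x \<in> carrier A \<Longrightarrow> \<one> \<otimes> x = x"
    and "\<And>x. x \<in> carrier A \<Longrightarrow> x \<otimes> \<one> = x"
    and "\<And>x y z. \<lbrakk>x \<in> carrier A; y \<in> carrier A; z \<in> carrier A\<rbrakk> \<Longrightarrow> (x \<oplus> y) \<otimes> z = x \<otimes> z \<oplus> y \<otimes> z"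
    and "\<And>x y z. \<lbrakk>x \<in> carrier A; y \<in> carrier A; z \<in> carrier A\<rbrakk> \<Longrightarrow> z \<otimes> (x \<oplus> y) = z \<otimes> x \<oplus> z \<otimes> y"
    and "\<And>c x y. \<lbrakk>x \<in> carrier A; y \<in> carrier A\<rbrakk> \<Longrightarrow> (c \<odot> x) \<otimes> y = c \<odot> (x \<otimes> y)"
    and "\<And>c x y. \<lbrakk>x \<in> carrier A; y \<in> carrier A\<rbrakk> \<Longrightarrow> x \<otimes> (c \<odot> y) = c \<odot> (x \<otimes> y)"
  shows "k_algebra A"
proof -
  interpret vspace A by (rule assms(1))
  have "ring A"
    by (intro ringI abelian_group_axioms monoidI) (use assms in auto)
  then show ?thesis
    by (intro k_algebra.intro k_algebra_axioms.intro assms(1)) (use assms in auto)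
qed

lemma k_algebra_bilinear_mult:
  assumes "k_algebra A"
  shows "bilinear_map A A A (mult A)"
proof -
  interpret k_algebra A by (rule assms)
  show ?thesis
    by (auto simp: bilinear_map_def l_distr r_distr scale_mult_left scale_mult_right)
qed

lemma pure_tensor_closed:
  "\<lbrakk>v \<in> carrier V; w \<in> carrier W\<rbrakk> \<Longrightarrow> pure_tensor V W v w \<in> carrier (tensor_space V W)"
  by (auto simp: pure_tensor_def tensor_carrier)

lemma pure_tensor_add_left:
  "\<lbrakk>v \<in> carrier V; v' \<in> carrier V; w \<in> carrier W\<rbrakk> \<Longrightarrow>
    pure_tensor V W (v \<oplus>\<^bsub>V\<^esub> v') w =
      pure_tensor V W v w \<oplus>\<^bsub>tensor_space V W\<^esub> pure_tensor V W v' w"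
  using tensor_relators_memI(1) [of v V v' w W]
  by (simp add: pure_tensor_def tensor_add tensor_class_eq_iff diff_diff_eq)

lemma pure_tensor_add_right:
  "\<lbrakk>v \<in> carrier V; w \<in> carrier W; w' \<in> carrier W\<rbrakk> \<Longrightarrow>
    pure_tensor V W v (w \<oplus>\<^bsub>W\<^esub> w') =
      pure_tensor V W v w \<oplus>\<^bsub>tensor_space V W\<^esub> pure_tensor V W v w'"
  using tensor_relators_memI(2) [of v V w W w']
  by (simp add: pure_tensor_def tensor_add tensor_class_eq_iff diff_diff_eq)

lemma pure_tensor_scale_left:
  "\<lbrakk>v \<in> carrier V; w \<in> carrier W\<rbrakk> \<Longrightarrow>
    pure_tensor V W (c \<odot>\<^bsub>V\<^esub> v) w = c \<odot>\<^bsub>tensor_space V W\<^esub> pure_tensor V W v w"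
  using tensor_relators_memI(3) [of v V w W c]
  by (simp add: pure_tensor_def tensor_smult tensor_class_eq_iff)

lemma pure_tensor_scale_right:
  "\<lbrakk>v \<in> carrier V; w \<in> carrier W\<rbrakk> \<Longrightarrow>
    pure_tensor V W v (c \<odot>\<^bsub>W\<^esub> w) = c \<odot>\<^bsub>tensor_space V W\<^esub> pure_tensor V W v w"
  using tensor_relators_memI(4) [of v V w W c]
  by (simp add: pure_tensor_def tensor_smult tensor_class_eq_iff)

lemma tensor_algebra_fields [simp]:
  "carrier (tensor_algebra A B) = carrier (tensor_space A B)"
  "\<zero>\<^bsub>tensor_algebra A B\<^esub> = \<zero>\<^bsub>tensor_space A B\<^esub>"
  "add (tensor_algebra A B) = add (tensor_space A B)"
  "smult (tensor_algebra A B) = smult (tensor_space A B)"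
  "\<one>\<^bsub>tensor_algebra A B\<^esub> = pure_tensor A B \<one>\<^bsub>A\<^esub> \<one>\<^bsub>B\<^esub>"
  by (simp_all add: tensor_algebra_def)

lemma tensor_algebra_mult:
  assumes "k_algebra A" "k_algebra B"
    and "Poly_Mapping.keys f \<subseteq> carrier A \<times> carrier B" "Poly_Mapping.keys g \<subseteq> carrier A \<times> carrier B"
  shows "tensor_class A B f \<otimes>\<^bsub>tensor_algebra A B\<^esub> tensor_class A B g =
    tensor_class A B (tensor_rep (mult A) (mult B) f g)"
  using assms
  by (simp add: tensor_algebra_def tensor_act_class k_algebra_bilinear_mult k_algebra.axioms)

lemma vspace_cong:
  assumes "vspace V" "carrier V' = carrier V" "\<zero>\<^bsub>V'\<^esub> = \<zero>\<^bsub>V\<^esub>" "add V' = add V" "smult V' = smult V"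
  shows "vspace V'"
proof -
  interpret vspace V by (rule assms)
  show ?thesis
    by (rule vspaceI)
      (auto simp: assms a_assoc l_zero scale_l_distr scale_r_distr scale_assoc intro: a_comm)
qed

lemma k_algebra_tensor:
  assumes A: "k_algebra A" and B: "k_algebra B"
  shows "k_algebra (tensor_algebra A B)"
proof (rule k_algebraI)
  interpret A: k_algebra A by (rule A)
  interpret B: k_algebra B by (rule B)
  note bil = k_algebra_bilinear_mult [OF A] k_algebra_bilinear_mult [OF B]
  show "vspace (tensor_algebra A B)"
    by (rule vspace_cong [OF vspace_tensor]) simp_all
  show "\<one>\<^bsub>tensor_algebra A B\<^esub> \<in> carrier (tensor_algebra A B)"
    by (simp add: pure_tensor_closed)
  have one_left: "tensor_rep (mult A) (mult B) (Poly_Mapping.single (\<one>\<^bsub>A\<^esub>, \<one>\<^bsub>B\<^esub>) 1) f = f"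
    if "Poly_Mapping.keys f \<subseteq> carrier A \<times> carrier B" for f
    using that by (induction rule: pm_induct) (auto simp: tensor_rep_linear)
  have one_right: "tensor_rep (mult A) (mult B) f (Poly_Mapping.single (\<one>\<^bsub>A\<^esub>, \<one>\<^bsub>B\<^esub>) 1) = f"
    if "Poly_Mapping.keys f \<subseteq> carrier A \<times> carrier B" for f
    using that by (induction rule: pm_induct) (auto simp: tensor_rep_linear)
  have one_keys: "Poly_Mapping.keys (Poly_Mapping.single (\<one>\<^bsub>A\<^esub>, \<one>\<^bsub>B\<^esub>) 1) \<subseteq> carrier A \<times> carrier B"
    by simp
  note mult = tensor_algebra_mult [OF A B]
  fix x y z and c
  assume "x \<in> carrier (tensor_algebra A B)"
  then obtain f where f: "Poly_Mapping.keys f \<subseteq> carrier A \<times> carrier B" "x = tensor_class A B f"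
    by (auto simp: tensor_carrier)
  show "\<one>\<^bsub>tensor_algebra A B\<^esub> \<otimes>\<^bsub>tensor_algebra A B\<^esub> x = x" "x \<otimes>\<^bsub>tensor_algebra A B\<^esub> \<one>\<^bsub>tensor_algebra A B\<^esub> = x"
    using f by (simp_all add: pure_tensor_def mult one_left one_right del: keys_single)
      (simp_all add: mult one_left one_right)
  assume "y \<in> carrier (tensor_algebra A B)"
  then obtain g where g: "Poly_Mapping.keys g \<subseteq> carrier A \<times> carrier B" "y = tensor_class A B g"
    by (auto simp: tensor_carrier)
  show "x \<otimes>\<^bsub>tensor_algebra A B\<^esub> y \<in> carrier (tensor_algebra A B)"
    using f g by (simp add: mult tensor_carrier keys_tensor_rep [OF bil])
  show "(c \<odot>\<^bsub>tensor_algebra A B\<^esub> x) \<otimes>\<^bsub>tensor_algebra A B\<^esub> y = c \<odot>\<^bsub>tensor_algebra A B\<^esub> (x \<otimes>\<^bsub>tensor_algebra A B\<^esub> y)"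
    "x \<otimes>\<^bsub>tensor_algebra A B\<^esub> (c \<odot>\<^bsub>tensor_algebra A B\<^esub> y) = c \<odot>\<^bsub>tensor_algebra A B\<^esub> (x \<otimes>\<^bsub>tensor_algebra A B\<^esub> y)"
    using f g by (simp_all add: mult tensor_smult keys_scale_subset tensor_rep_linear)
  assume "z \<in> carrier (tensor_algebra A B)"
  then obtain h where h: "Poly_Mapping.keys h \<subseteq> carrier A \<times> carrier B" "z = tensor_class A B h"
    by (auto simp: tensor_carrier)
  show "x \<otimes>\<^bsub>tensor_algebra A B\<^esub> y \<otimes>\<^bsub>tensor_algebra A B\<^esub> z =
      x \<otimes>\<^bsub>tensor_algebra A B\<^esub> (y \<otimes>\<^bsub>tensor_algebra A B\<^esub> z)"
    using f g h
    by (simp add: mult keys_tensor_rep [OF bil] A.m_assoc B.m_assoc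
        tensor_rep_assoc [where A = A and B = B and V = A and W = B])
  show "(x \<oplus>\<^bsub>tensor_algebra A B\<^esub> y) \<otimes>\<^bsub>tensor_algebra A B\<^esub> z =
      x \<otimes>\<^bsub>tensor_algebra A B\<^esub> z \<oplus>\<^bsub>tensor_algebra A B\<^esub> y \<otimes>\<^bsub>tensor_algebra A B\<^esub> z"
    "z \<otimes>\<^bsub>tensor_algebra A B\<^esub> (x \<oplus>\<^bsub>tensor_algebra A B\<^esub> y) =
      z \<otimes>\<^bsub>tensor_algebra A B\<^esub> x \<oplus>\<^bsub>tensor_algebra A B\<^esub> z \<otimes>\<^bsub>tensor_algebra A B\<^esub> y"
    using f g h by (simp_all add: mult tensor_add keys_add_subset tensor_rep_linear)
qed

lemma pure_tensor_mult:
  assumes "k_algebra A" "k_algebra B"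
    and "a \<in> carrier A" "a' \<in> carrier A" "b \<in> carrier B" "b' \<in> carrier B"
  shows "pure_tensor A B a b \<otimes>\<^bsub>tensor_algebra A B\<^esub> pure_tensor A B a' b' =
    pure_tensor A B (a \<otimes>\<^bsub>A\<^esub> a') (b \<otimes>\<^bsub>B\<^esub> b')"
  using assms by (simp add: pure_tensor_def tensor_algebra_mult)

section \<open>The universal property of the free algebra\<close>

lemma free_algebra_fields [simp]:
  "carrier free_algebra = UNIV" "mult free_algebra = (*)" "\<one>\<^bsub>free_algebra\<^esub> = 1"
  "\<zero>\<^bsub>free_algebra\<^esub> = 0" "add free_algebra = (+)" "smult free_algebra = scale_pm"
  by (simp_all add: free_algebra_def)

lemma scale_pm_conv_mult: "scale_pm c f = Poly_Mapping.single 0 c * f"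
  by (simp add: scale_pm_def mult_map_scale_conv_mult)

text \<open>Constants are central although words do not commute: 0 is the empty word, neutral for
  concatenation on both sides.\<close>

lemma single_0_commute:
  "f * Poly_Mapping.single 0 c = Poly_Mapping.single 0 c * (f :: 'x word \<Rightarrow>\<^sub>0 'k::field)"
proof -
  have "Poly_Mapping.keys f \<subseteq> UNIV" by simp
  then show ?thesis
  proof (induction rule: pm_induct)
    case (scale d f)
    have "Poly_Mapping.single (0 :: 'x word) d * Poly_Mapping.single 0 c =
        Poly_Mapping.single 0 c * Poly_Mapping.single 0 d"
      by (simp add: mult_single mult.commute)
    then show ?case
      unfolding scale_pm_conv_mult mult.assoc scale by (simp only: mult.assoc [symmetric])
  qed (simp_all add: distrib_left distrib_right mult_single)
qed

lemma scale_pm_mult_left: "scale_pm c f * g = scale_pm c (f * g :: 'x word \<Rightarrow>\<^sub>0 'k::field)"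
  by (simp add: scale_pm_conv_mult mult.assoc)

lemma scale_pm_mult_right: "f * scale_pm c g = scale_pm c (f * g :: 'x word \<Rightarrow>\<^sub>0 'k::field)"
  by (metis scale_pm_conv_mult mult.assoc single_0_commute)

lemma k_algebra_free: "k_algebra free_algebra"
  by (intro k_algebraI vspaceI)
    (simp_all add: algebra_simps scale_pm_mult_left scale_pm_mult_right)

section \<open>Evaluation of the free algebra in an algebra\<close>

context k_algebra
begin

definition word_eval :: "('g \<Rightarrow> 'a) \<Rightarrow> 'g word \<Rightarrow> 'a"
  where "word_eval \<phi> w = foldr (\<lambda>x t. \<phi> x \<otimes> t) (letters w) \<one>"

lemma word_eval_closed [simp]:
  assumes "\<And>x. \<phi> x \<in> carrier A"
  shows "word_eval \<phi> w \<in> carrier A"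
proof -
  have "foldr (\<lambda>x t. \<phi> x \<otimes> t) l \<one> \<in> carrier A" for l
    by (induction l) (simp_all add: assms)
  then show ?thesis by (simp add: word_eval_def)
qed

lemma word_eval_add:
  assumes "\<And>x. \<phi> x \<in> carrier A"
  shows "word_eval \<phi> (u + v) = word_eval \<phi> u \<otimes> word_eval \<phi> v"
proof -
  have c: "foldr (\<lambda>x t. \<phi> x \<otimes> t) l \<one> \<in> carrier A" for l
    using word_eval_closed [of \<phi> "Word l"] assms by (simp add: word_eval_def)
  have "foldr (\<lambda>x t. \<phi> x \<otimes> t) (l @ l') \<one> =
      foldr (\<lambda>x t. \<phi> x \<otimes> t) l \<one> \<otimes> foldr (\<lambda>x t. \<phi> x \<otimes> t) l' \<one>" for l l'
    by (induction l) (use c in \<open>auto simp: assms m_assoc\<close>)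
  then show ?thesis by (simp add: word_eval_def plus_word_def del: foldr_append)
qed

lemma free_extend_superset:
  assumes \<phi>: "\<And>x. \<phi> x \<in> carrier A" and "finite X" "Poly_Mapping.keys f \<subseteq> X"
  shows "free_extend A \<phi> f = (\<Oplus>w\<in>X. Poly_Mapping.lookup f w \<odot> word_eval \<phi> w)"
  unfolding free_extend_def word_eval_def [symmetric]
  by (rule add.finprod_mono_neutral_cong_left)
    (use assms in \<open>auto simp: in_keys_iff\<close>)

lemma free_extend_closed [simp]:
  "(\<And>x. \<phi> x \<in> carrier A) \<Longrightarrow> free_extend A \<phi> f \<in> carrier A"
  by (auto simp: free_extend_superset [of \<phi> "Poly_Mapping.keys f"] intro!: finsum_closed)

lemma free_extend_0 [simp]: "free_extend A \<phi> 0 = \<zero>"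
  by (simp add: free_extend_def)

lemma free_extend_add:
  assumes \<phi>: "\<And>x. \<phi> x \<in> carrier A"
  shows "free_extend A \<phi> (f + g) = free_extend A \<phi> f \<oplus> free_extend A \<phi> g"
proof -
  let ?X = "Poly_Mapping.keys f \<union> Poly_Mapping.keys g"
  have "free_extend A \<phi> f \<oplus> free_extend A \<phi> g = 
    (\<Oplus>w\<in>?X. Poly_Mapping.lookup f w \<odot> word_eval \<phi> w \<oplus> Poly_Mapping.lookup g w \<odot> word_eval \<phi> w)"
    using \<phi> free_extend_superset [OF \<phi>, of ?X f] free_extend_superset [OF \<phi>, of ?X g]
    by (simp add: finsum_addf Pi_def)
  also have "\<dots> = (\<Oplus>w\<in>?X. Poly_Mapping.lookup (f + g) w \<odot> word_eval \<phi> w)"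
    using \<phi> by (intro finsum_cong') (auto simp: lookup_add scale_l_distr)
  also have "\<dots> = free_extend A \<phi> (f + g)"
    using free_extend_superset [OF \<phi>, of ?X "f + g"] Poly_Mapping.keys_add [of f g] by simp
  finally show ?thesis by simp
qed

lemma free_extend_single:
  "(\<And>x. \<phi> x \<in> carrier A) \<Longrightarrow> free_extend A \<phi> (Poly_Mapping.single w c) = c \<odot> word_eval \<phi> w"
  by (subst free_extend_superset [of \<phi> "{w}"]) auto

lemma free_extend_scale:
  assumes \<phi>: "\<And>x. \<phi> x \<in> carrier A"
  shows "free_extend A \<phi> (scale_pm c f) = c \<odot> free_extend A \<phi> f"
proof -
  have "Poly_Mapping.keys f \<subseteq> UNIV" by simp
  then show ?thesis
  proof (induction arbitrary: c rule: pm_induct)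
    case (scale d f)
    then show ?case
      using \<phi> by (simp only: pm.scale_scale scale_assoc free_extend_closed)
  qed (use \<phi> in \<open>simp_all add: free_extend_add free_extend_single pm.scale_right_distrib scale_r_distr\<close>)
qed

lemma free_extend_mult:
  assumes \<phi>: "\<And>x. \<phi> x \<in> carrier A"
  shows "free_extend A \<phi> (f * g) = free_extend A \<phi> f \<otimes> free_extend A \<phi> g"
proof -
  have fg: "Poly_Mapping.keys f \<subseteq> UNIV" "Poly_Mapping.keys g \<subseteq> UNIV" by simp_all
  note simps = free_extend_add free_extend_scale free_extend_single
    scale_pm_mult_left scale_pm_mult_right scale_mult_left scale_mult_right l_distr r_distr
    distrib_left distrib_right
  from fg(1) show ?thesis
  proof (induction rule: pm_induct)
    case (single u)
    from fg(2) show ?case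
      by (induction rule: pm_induct) (use \<phi> in \<open>simp_all add: simps mult_single word_eval_add\<close>)
  qed (use \<phi> in \<open>simp_all add: simps\<close>)
qed

lemma free_extend_one: "free_extend A \<phi> (1 :: 'g word \<Rightarrow>\<^sub>0 'k) = \<one>"
proof -
  have "letters (0 :: 'g word) = []" by (simp add: zero_word_def)
  then show ?thesis by (simp add: free_extend_def)
qed

lemma free_extend_gen: "(\<And>x. \<phi> x \<in> carrier A) \<Longrightarrow> free_extend A \<phi> (free_gen x) = \<phi> x"
  by (simp add: free_gen_def free_extend_single word_eval_def)

lemma free_extend_diff:
  assumes \<phi>: "\<And>x. \<phi> x \<in> carrier A"
  shows "free_extend A \<phi> (f - g) = free_extend A \<phi> f \<ominus> free_extend A \<phi> g"
proof -
  have "free_extend A \<phi> (f - g) \<oplus> free_extend A \<phi> g = free_extend A \<phi> f"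
    using free_extend_add [of \<phi> "f - g" g] \<phi> by simp
  then show ?thesis
    using \<phi> by (metis add.inv_solve_right' free_extend_closed minus_eq)
qed

end

section \<open>The algebra \<open>\<uu>(\<mm>)\<close> by generators and relations\<close>

lemma a_minus_free_algebra [simp]: "f \<ominus>\<^bsub>free_algebra\<^esub> g = f - g"
proof -
  interpret k_algebra free_algebra by (rule k_algebra_free)
  have "\<ominus>\<^bsub>free_algebra\<^esub> g = - g"
    by (rule minus_equality) simp_all
  then show ?thesis by (simp add: a_minus_def)
qed

lemma ideal_um_ideal: "ideal um_ideal free_algebra"
proof -
  interpret k_algebra free_algebra by (rule k_algebra_free)
  show ?thesis unfolding um_ideal_def by (rule genideal_ideal) simp
qed

lemma um_class_eq_iff: "um_class f = um_class g \<longleftrightarrow> f - g \<in> um_ideal"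
proof -
  interpret k_algebra free_algebra by (rule k_algebra_free)
  show ?thesis
    using quotient_eq_iff_same_a_r_cos [OF ideal_um_ideal, of f g] by (simp add: um_class_def)
qed

lemma um_class_eq_0: "f \<in> um_ideal \<Longrightarrow> um_class f = um_class 0"
  by (simp add: um_class_eq_iff)

lemma um_carrier: "carrier um = range um_class"
  by (auto simp: um_def ring.defs module.defs FactRing_def A_RCOSETS_def' um_class_def)

lemma um_class_closed [simp]: "um_class f \<in> carrier um"
  by (simp add: um_carrier)

lemma um_ops:
  fixes f g :: "um_gen word \<Rightarrow>\<^sub>0 'k::field"
  shows "\<zero>\<^bsub>um\<^esub> = (um_class 0 :: 'k um)" "\<one>\<^bsub>um\<^esub> = (um_class 1 :: 'k um)"
  "um_class f \<oplus>\<^bsub>um\<^esub> um_class g = um_class (f + g)"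
  "um_class f \<otimes>\<^bsub>um\<^esub> um_class g = um_class (f * g)"
  "c \<odot>\<^bsub>um\<^esub> um_class f = um_class (scale_pm c f)"
proof -
  interpret ideal um_ideal "free_algebra :: ('k, um_gen word \<Rightarrow>\<^sub>0 'k) module" by (rule ideal_um_ideal)
  have mult: "rcoset_mult free_algebra um_ideal (um_class f) (um_class g) = um_class (f * g)"
    for f g :: "um_gen word \<Rightarrow>\<^sub>0 'k"
    using rcoset_mult_add [of f g] by (simp add: um_class_def)
  show "\<zero>\<^bsub>um\<^esub> = (um_class 0 :: 'k um)"
    using a_coset_add_zero [of um_ideal] a_subset
    by (simp add: um_def ring.defs module.defs FactRing_def um_class_def)
  show "\<one>\<^bsub>um\<^esub> = (um_class 1 :: 'k um)"
    by (simp add: um_def ring.defs module.defs FactRing_def um_class_def)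
  show "um_class f \<oplus>\<^bsub>um\<^esub> um_class g = um_class (f + g)"
    using a_rcos_sum [of f g]
    by (simp add: um_def ring.defs module.defs FactRing_def um_class_def)
  show "um_class f \<otimes>\<^bsub>um\<^esub> um_class g = um_class (f * g)"
    using mult by (simp add: um_def ring.defs module.defs FactRing_def)
  show "c \<odot>\<^bsub>um\<^esub> um_class f = um_class (scale_pm c f)"
    using mult by (simp add: um_def ring.defs module.defs FactRing_def scale_pm_mult_left)
qed

lemma k_algebra_um: "k_algebra um"
  by (intro k_algebraI vspaceI)
    (auto simp: um_carrier um_ops algebra_simps scale_pm_mult_left scale_pm_mult_right)

interpretation um: k_algebra um
  by (rule k_algebra_um)

lemma um_gen_elem_closed [simp]: "um_gen_elem x \<in> carrier um"
  by (simp add: um_gen_elem_def)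

lemma um_relators_class:
  assumes "r \<in> um_relators"
  shows "um_class r = um_class 0"
proof (rule um_class_eq_0)
  interpret k_algebra free_algebra by (rule k_algebra_free)
  show "r \<in> um_ideal"
    using genideal_self [of um_relators] assms by (auto simp: um_ideal_def)
qed

text \<open>Classes of words span \<open>um\<close>, and a word grows by one letter on the left.
  This is the form in which equivariance under the generators extends to all of
  \<open>um\<close>.\<close>

lemma um_induct [consumes 1, case_names one add scale gen]:
  assumes "u \<in> carrier um"
    and one: "P \<one>\<^bsub>um\<^esub>"
    and add: "\<And>u v. \<lbrakk>u \<in> carrier um; v \<in> carrier um; P u; P v\<rbrakk> \<Longrightarrow> P (u \<oplus>\<^bsub>um\<^esub> v)"
    and scale: "\<And>c u. \<lbrakk>u \<in> carrier um; P u\<rbrakk> \<Longrightarrow> P (c \<odot>\<^bsub>um\<^esub> u)"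
    and gen: "\<And>x u. \<lbrakk>u \<in> carrier um; P u\<rbrakk> \<Longrightarrow> P (um_gen_elem x \<otimes>\<^bsub>um\<^esub> u)"
  shows "P u"
proof -
  obtain f where u: "u = um_class f"
    using assms(1) by (auto simp: um_carrier)
  have "Poly_Mapping.keys f \<subseteq> UNIV" by simp
  then have "P (um_class f)"
  proof (induction rule: pm_induct)
    case zero
    show ?case
      using scale [of "\<one>\<^bsub>um\<^esub>" 0] one by (simp add: um_ops)
  next
    case (add f g)
    then show ?case
      using assms(3) [of "um_class f" "um_class g"] by (simp add: um_ops)
  next
    case (scale c f)
    then show ?case
      using assms(4) [of "um_class f" c] by (simp add: um_ops)
  next
    case (single w)
    have "P (um_class (Poly_Mapping.single (Word l) 1))" for l
    proof (induction l)
      case Nil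
      have "Poly_Mapping.single (Word []) 1 = (1 :: um_gen word \<Rightarrow>\<^sub>0 'a)"
        by (metis single_one zero_word_def)
      then show ?case using one by (simp add: um_ops)
    next
      case (Cons x l)
      then show ?case
        using gen [of "um_class (Poly_Mapping.single (Word l) 1)" x]
        by (simp add: um_ops um_gen_elem_def free_gen_def mult_single plus_word_def)
    qed
    then show ?case by (metis word.exhaust_sel)
  qed
  then show ?thesis by (simp add: u)
qed

text \<open>The data of an algebra homomorphism out of \<open>um\<close>. Fourth powers are
  bracketed as squares of squares, so that for the comultiplication \<open>square_sum\<close>
  settles them in two steps.\<close>

locale um_rep = k_algebra A for A :: "('k::field, 'a, 'x) module_scheme" (structure) +
  fixes \<phi> :: "um_gen \<Rightarrow> 'a"
  assumes gen_closed [simp]: "\<phi> x \<in> carrier A"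
    and rel_ab: "\<phi> Gen_a \<otimes> \<phi> Gen_b \<oplus> \<phi> Gen_b \<otimes> \<phi> Gen_a = \<phi> Gen_c"
    and rel_ac: "\<phi> Gen_a \<otimes> \<phi> Gen_c \<oplus> \<phi> Gen_c \<otimes> \<phi> Gen_a = \<phi> Gen_a"
    and rel_bc: "\<phi> Gen_b \<otimes> \<phi> Gen_c \<oplus> \<phi> Gen_c \<otimes> \<phi> Gen_b = \<phi> Gen_b"
    and rel_a: "(\<phi> Gen_a \<otimes> \<phi> Gen_a) \<otimes> (\<phi> Gen_a \<otimes> \<phi> Gen_a) = \<zero>"
    and rel_b: "(\<phi> Gen_b \<otimes> \<phi> Gen_b) \<otimes> (\<phi> Gen_b \<otimes> \<phi> Gen_b) = \<zero>"
    and rel_c: "\<phi> Gen_c \<otimes> \<phi> Gen_c \<oplus> \<phi> Gen_c = \<zero>"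
begin

lemmas free_extend_simps = free_extend_add [of \<phi>, OF gen_closed] free_extend_diff [of \<phi>, OF gen_closed]
  free_extend_mult [of \<phi>, OF gen_closed] free_extend_scale [of \<phi>, OF gen_closed]
  free_extend_gen [of \<phi>, OF gen_closed] free_extend_one

lemma free_extend_relator:
  assumes "r \<in> um_relators"
  shows "free_extend A \<phi> r = \<zero>"
proof -
  have four: "x ^ 4 = (x * x) * (x * x)" for x :: "um_gen word \<Rightarrow>\<^sub>0 'k"
    by (simp add: numeral_eq_Suc mult.assoc)
  have two: "x ^ 2 = x * x" for x :: "um_gen word \<Rightarrow>\<^sub>0 'k"
    by (rule power2_eq_square)
  show ?thesis
    using assms unfolding um_relators_def Let_def four two
    by (auto simp: free_extend_simps rel_ab rel_ac rel_bc rel_a rel_b rel_c a_minus_def r_neg)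
qed

text \<open>The elements killed by the evaluation form a two-sided ideal containing the relators,
  and \<open>um_ideal\<close> is the least such ideal.\<close>

lemma free_extend_um_ideal:
  assumes "f \<in> um_ideal"
  shows "free_extend A \<phi> f = \<zero>"
proof -
  interpret F: k_algebra "free_algebra :: ('k, um_gen word \<Rightarrow>\<^sub>0 'k) module" by (rule k_algebra_free)
  have closed: "free_extend A \<phi> f \<in> carrier A" for f by simp
  have uminus: "\<ominus>\<^bsub>free_algebra\<^esub> f = - f" for f :: "um_gen word \<Rightarrow>\<^sub>0 'k"
    by (rule F.minus_equality) simp_all
  have neg: "free_extend A \<phi> (- f) = \<zero>" if "free_extend A \<phi> f = \<zero>" for f
    using free_extend_diff [of \<phi> 0 f] that by (simp add: a_minus_def)
  have "ideal {f. free_extend A \<phi> f = \<zero>} free_algebra"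
  proof (rule idealI)
    show "subgroup {f. free_extend A \<phi> f = \<zero>} (add_monoid free_algebra)"
      by (rule subgroup.intro)
        (simp_all only: a_inv_def [symmetric] mem_Collect_eq uminus,
          simp_all add: free_extend_simps closed neg)
  qed (simp_all add: F.ring_axioms free_extend_simps closed)
  then have "um_ideal \<subseteq> {f. free_extend A \<phi> f = \<zero>}"
    unfolding um_ideal_def
    by (rule F.genideal_minimal) (auto simp: free_extend_relator)
  then show ?thesis using assms by auto
qed

lemma quot_extend_class: "quot_extend A \<phi> (um_class f) = free_extend A \<phi> f"
proof -
  have eq: "free_extend A \<phi> g = free_extend A \<phi> f" if "um_class g = um_class f" for g
  proof -
    have "g - f \<in> um_ideal" using that by (simp add: um_class_eq_iff)
    then have "free_extend A \<phi> ((g - f) + f) = \<zero> \<oplus> free_extend A \<phi> f"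
      unfolding free_extend_simps(1) by (simp only: free_extend_um_ideal)
    then show ?thesis by simp
  qed
  have mem: "g \<in> um_class f \<longleftrightarrow> um_class g = um_class f" for g
  proof -
    have "um_class f = (\<lambda>h. h + f) ` um_ideal"
      by (auto simp: um_class_def a_r_coset_defs)
    then have "g \<in> um_class f \<longleftrightarrow> g - f \<in> um_ideal"
      by (auto intro: image_eqI [of _ _ "g - f"])
    then show ?thesis by (simp add: um_class_eq_iff)
  qed
  have "free_extend A \<phi> ` um_class f = {free_extend A \<phi> f}"
  proof
    show "free_extend A \<phi> ` um_class f \<subseteq> {free_extend A \<phi> f}"
      using eq mem by blast
    show "{free_extend A \<phi> f} \<subseteq> free_extend A \<phi> ` um_class f"
      using mem by blast
  qed
  then show ?thesis by (simp add: quot_extend_def)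
qed

lemma quot_extend_closed [simp]: "u \<in> carrier um \<Longrightarrow> quot_extend A \<phi> u \<in> carrier A"
  by (auto simp: um_carrier quot_extend_class)

lemma quot_extend_one: "quot_extend A \<phi> \<one>\<^bsub>um\<^esub> = \<one>"
  by (simp add: um_ops quot_extend_class free_extend_simps)

lemma quot_extend_add:
  "\<lbrakk>u \<in> carrier um; v \<in> carrier um\<rbrakk> \<Longrightarrow>
    quot_extend A \<phi> (u \<oplus>\<^bsub>um\<^esub> v) = quot_extend A \<phi> u \<oplus> quot_extend A \<phi> v"
  by (auto simp: um_carrier um_ops quot_extend_class free_extend_simps)

lemma quot_extend_mult:
  "\<lbrakk>u \<in> carrier um; v \<in> carrier um\<rbrakk> \<Longrightarrow>
    quot_extend A \<phi> (u \<otimes>\<^bsub>um\<^esub> v) = quot_extend A \<phi> u \<otimes> quot_extend A \<phi> v"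
  by (auto simp: um_carrier um_ops quot_extend_class free_extend_simps)

lemma quot_extend_scale:
  "u \<in> carrier um \<Longrightarrow> quot_extend A \<phi> (c \<odot>\<^bsub>um\<^esub> u) = c \<odot> quot_extend A \<phi> u"
  by (auto simp: um_carrier um_ops quot_extend_class free_extend_simps)

lemma quot_extend_gen: "quot_extend A \<phi> (um_gen_elem x) = \<phi> x"
  by (simp add: um_gen_elem_def quot_extend_class free_extend_simps)

end

lemma um_relations:
  fixes a b c :: "'k::field um"
  defines "a \<equiv> um_gen_elem Gen_a" and "b \<equiv> um_gen_elem Gen_b" and "c \<equiv> um_gen_elem Gen_c"
  shows "a \<otimes>\<^bsub>um\<^esub> b \<oplus>\<^bsub>um\<^esub> b \<otimes>\<^bsub>um\<^esub> a = c"
    and "a \<otimes>\<^bsub>um\<^esub> c \<oplus>\<^bsub>um\<^esub> c \<otimes>\<^bsub>um\<^esub> a = a"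
    and "b \<otimes>\<^bsub>um\<^esub> c \<oplus>\<^bsub>um\<^esub> c \<otimes>\<^bsub>um\<^esub> b = b"
    and "(a \<otimes>\<^bsub>um\<^esub> a) \<otimes>\<^bsub>um\<^esub> (a \<otimes>\<^bsub>um\<^esub> a) = \<zero>\<^bsub>um\<^esub>"
    and "(b \<otimes>\<^bsub>um\<^esub> b) \<otimes>\<^bsub>um\<^esub> (b \<otimes>\<^bsub>um\<^esub> b) = \<zero>\<^bsub>um\<^esub>"
    and "c \<otimes>\<^bsub>um\<^esub> c \<oplus>\<^bsub>um\<^esub> c = \<zero>\<^bsub>um\<^esub>"
proof -
  have sub: "um_class f = um_class g" if "f - g \<in> um_relators" for f g :: "um_gen word \<Rightarrow>\<^sub>0 'k"
    using um_relators_class [OF that] by (simp add: um_class_eq_iff)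
  have four: "(x * x) * (x * x) = x ^ 4" for x :: "um_gen word \<Rightarrow>\<^sub>0 'k"
    by (simp add: numeral_eq_Suc mult.assoc)
  show "a \<otimes>\<^bsub>um\<^esub> b \<oplus>\<^bsub>um\<^esub> b \<otimes>\<^bsub>um\<^esub> a = c"
    "a \<otimes>\<^bsub>um\<^esub> c \<oplus>\<^bsub>um\<^esub> c \<otimes>\<^bsub>um\<^esub> a = a"
    "b \<otimes>\<^bsub>um\<^esub> c \<oplus>\<^bsub>um\<^esub> c \<otimes>\<^bsub>um\<^esub> b = b"
    "(a \<otimes>\<^bsub>um\<^esub> a) \<otimes>\<^bsub>um\<^esub> (a \<otimes>\<^bsub>um\<^esub> a) = \<zero>\<^bsub>um\<^esub>"
    "(b \<otimes>\<^bsub>um\<^esub> b) \<otimes>\<^bsub>um\<^esub> (b \<otimes>\<^bsub>um\<^esub> b) = \<zero>\<^bsub>um\<^esub>"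
    "c \<otimes>\<^bsub>um\<^esub> c \<oplus>\<^bsub>um\<^esub> c = \<zero>\<^bsub>um\<^esub>"
    unfolding a_def b_def c_def um_gen_elem_def um_ops four
    by (intro sub; simp add: um_relators_def power2_eq_square Let_def)+
qed

section \<open>The comultiplication and tensor products of modules\<close>

lemma (in vspace) double_eq_zero:
  assumes "CHAR('k) = 2" "x \<in> carrier V"
  shows "x \<oplus> x = \<zero>"
proof -
  have "(1 + 1 :: 'k) = 0"
    using of_nat_CHAR [where 'a = 'k] assms(1) by simp
  then show ?thesis
    using scale_l_distr [of x 1 1] assms(2) by simp
qed

section \<open>Primitive elements in characteristic 2\<close>

context ring
begin

text \<open>The model is x = u \<otimes> 1, x' = 1 \<otimes> u and likewise y, y' from v. Each mixed
  product occurs twice and cancels, so the anticommutator of primitive elements is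
  primitive.\<close>

lemma anticommutator_sum:
  assumes [simp]: "x \<in> carrier R" "x' \<in> carrier R" "y \<in> carrier R" "y' \<in> carrier R"
    and comm: "x' \<otimes> y = y \<otimes> x'" "x \<otimes> y' = y' \<otimes> x"
    and double: "\<And>z. z \<in> carrier R \<Longrightarrow> z \<oplus> z = \<zero>"
  shows "(x \<oplus> x') \<otimes> (y \<oplus> y') \<oplus> (y \<oplus> y') \<otimes> (x \<oplus> x') =
    (x \<otimes> y \<oplus> y \<otimes> x) \<oplus> (x' \<otimes> y' \<oplus> y' \<otimes> x')"
proof -
  have "z \<oplus> (z \<oplus> w) = w" if "z \<in> carrier R" "w \<in> carrier R" for z w
    using that by (simp add: double flip: a_assoc)
  then show ?thesis
    by (simp add: l_distr r_distr comm a_ac double)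
qed

lemma square_sum:
  assumes [simp]: "x \<in> carrier R" "y \<in> carrier R"
    and comm: "x \<otimes> y = y \<otimes> x"
    and double: "\<And>z. z \<in> carrier R \<Longrightarrow> z \<oplus> z = \<zero>"
  shows "(x \<oplus> y) \<otimes> (x \<oplus> y) = x \<otimes> x \<oplus> y \<otimes> y"
proof -
  have "z \<oplus> (z \<oplus> w) = w" if "z \<in> carrier R" "w \<in> carrier R" for z w
    using that by (simp add: double flip: a_assoc)
  then show ?thesis
    by (simp add: l_distr r_distr comm a_ac)
qed

end

lemma pure_tensor_zero:
  fixes V :: "('k::field, 'v, 'x) module_scheme" and W :: "('k, 'w, 'y) module_scheme"
  assumes "vspace V" "vspace W" "v \<in> carrier V" "w \<in> carrier W"
  shows "pure_tensor V W \<zero>\<^bsub>V\<^esub> w = \<zero>\<^bsub>tensor_space V W\<^esub>" "pure_tensor V W v \<zero>\<^bsub>W\<^esub> = \<zero>\<^bsub>tensor_space V W\<^esub>"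
proof -
  interpret V: vspace V by (rule assms)
  interpret W: vspace W by (rule assms)
  interpret T: vspace "tensor_space V W" by (rule vspace_tensor)
  show "pure_tensor V W \<zero>\<^bsub>V\<^esub> w = \<zero>\<^bsub>tensor_space V W\<^esub>"
    using pure_tensor_scale_left [of "\<zero>\<^bsub>V\<^esub>" V w W 0] assms by (simp add: pure_tensor_closed)
  show "pure_tensor V W v \<zero>\<^bsub>W\<^esub> = \<zero>\<^bsub>tensor_space V W\<^esub>"
    using pure_tensor_scale_right [of v V "\<zero>\<^bsub>W\<^esub>" W 0] assms by (simp add: pure_tensor_closed)
qed

abbreviation um_coprod :: "um_gen \<Rightarrow> ('k::field um \<times> 'k um \<Rightarrow>\<^sub>0 'k) set"
  where "um_coprod x \<equiv> pure_tensor um um (um_gen_elem x) \<one>\<^bsub>um\<^esub>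
         \<oplus>\<^bsub>tensor_algebra um um\<^esub> pure_tensor um um \<one>\<^bsub>um\<^esub> (um_gen_elem x)"

text \<open>Characteristic 2 enters the Hopf structure here: anticommutators, squares and fourth
  powers of elements u \<otimes> 1 + 1 \<otimes> u again have the form w \<otimes> 1 + 1 \<otimes>
  w, so each relation of \<open>um\<close> passes to the tensor square.\<close>

lemma um_rep_coprod:
  assumes char: "CHAR('k::field) = 2"
  shows "um_rep (tensor_algebra (um :: ('k, 'k um) module) um) um_coprod"
proof -
  let ?T = "tensor_algebra (um :: ('k, 'k um) module) um"
  interpret T: k_algebra ?T by (intro k_algebra_tensor k_algebra_um)
  define l where "l u = pure_tensor um um u \<one>\<^bsub>um\<^esub>" for u :: "'k um"
  define r where "r u = pure_tensor um um \<one>\<^bsub>um\<^esub> u" for u :: "'k um"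
  have lr [simp]: "l u \<in> carrier ?T" "r u \<in> carrier ?T" if "u \<in> carrier um" for u
    using that by (simp_all add: l_def r_def pure_tensor_closed)
  have mult: "l u \<otimes>\<^bsub>?T\<^esub> l v = l (u \<otimes>\<^bsub>um\<^esub> v)" "r u \<otimes>\<^bsub>?T\<^esub> r v = r (u \<otimes>\<^bsub>um\<^esub> v)"
    "r u \<otimes>\<^bsub>?T\<^esub> l v = l v \<otimes>\<^bsub>?T\<^esub> r u"
    if "u \<in> carrier um" "v \<in> carrier um" for u v
    using that by (simp_all add: l_def r_def pure_tensor_mult k_algebra_um)
  have add: "l u \<oplus>\<^bsub>?T\<^esub> l v = l (u \<oplus>\<^bsub>um\<^esub> v)" "r u \<oplus>\<^bsub>?T\<^esub> r v = r (u \<oplus>\<^bsub>um\<^esub> v)"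
    if "u \<in> carrier um" "v \<in> carrier um" for u v
    using that by (simp_all add: l_def r_def pure_tensor_add_left pure_tensor_add_right)
  have zero: "l \<zero>\<^bsub>um\<^esub> = \<zero>\<^bsub>?T\<^esub>" "r \<zero>\<^bsub>um\<^esub> = \<zero>\<^bsub>?T\<^esub>"
    using pure_tensor_zero [OF um.vspace_axioms um.vspace_axioms um.one_closed um.one_closed]
    by (simp_all add: l_def r_def)
  have double: "z \<oplus>\<^bsub>?T\<^esub> z = \<zero>\<^bsub>?T\<^esub>" if "z \<in> carrier ?T" for z
    by (rule T.double_eq_zero [OF char that])
  have anti: "(l u \<oplus>\<^bsub>?T\<^esub> r u) \<otimes>\<^bsub>?T\<^esub> (l v \<oplus>\<^bsub>?T\<^esub> r v) \<oplus>\<^bsub>?T\<^esub> (l v \<oplus>\<^bsub>?T\<^esub> r v) \<otimes>\<^bsub>?T\<^esub> (l u \<oplus>\<^bsub>?T\<^esub> r u) =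
      l w \<oplus>\<^bsub>?T\<^esub> r w"
    if "u \<in> carrier um" "v \<in> carrier um" "u \<otimes>\<^bsub>um\<^esub> v \<oplus>\<^bsub>um\<^esub> v \<otimes>\<^bsub>um\<^esub> u = w" for u v w
    using T.anticommutator_sum [of "l u" "r u" "l v" "r v"] that double
    by (simp add: mult add del: tensor_algebra_fields)
  have square: "(l u \<oplus>\<^bsub>?T\<^esub> r u) \<otimes>\<^bsub>?T\<^esub> (l u \<oplus>\<^bsub>?T\<^esub> r u) = l (u \<otimes>\<^bsub>um\<^esub> u) \<oplus>\<^bsub>?T\<^esub> r (u \<otimes>\<^bsub>um\<^esub> u)"
    if "u \<in> carrier um" for u
    using T.square_sum [of "l u" "r u"] that double
    by (simp add: mult del: tensor_algebra_fields)
  have sum: "(l u \<oplus>\<^bsub>?T\<^esub> r u) \<oplus>\<^bsub>?T\<^esub> (l v \<oplus>\<^bsub>?T\<^esub> r v) = l (u \<oplus>\<^bsub>um\<^esub> v) \<oplus>\<^bsub>?T\<^esub> r (u \<oplus>\<^bsub>um\<^esub> v)"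
    if "u \<in> carrier um" "v \<in> carrier um" for u v
    using that T.a_assoc T.a_lcomm by (simp del: tensor_algebra_fields flip: add)
  have "um_rep ?T (\<lambda>x. l (um_gen_elem x) \<oplus>\<^bsub>?T\<^esub> r (um_gen_elem x))"
  proof (intro um_rep.intro um_rep_axioms.intro T.k_algebra_axioms)
  qed (simp_all add: anti um_relations square sum zero del: tensor_algebra_fields)
  then show ?thesis by (simp add: l_def r_def)
qed

lemma restrict_scalars_fields [simp]:
  "carrier (restrict_scalars A M) = carrier M" "\<zero>\<^bsub>restrict_scalars A M\<^esub> = \<zero>\<^bsub>M\<^esub>"
  "add (restrict_scalars A M) = add M"
  "c \<odot>\<^bsub>restrict_scalars A M\<^esub> x = (c \<odot>\<^bsub>A\<^esub> \<one>\<^bsub>A\<^esub>) \<odot>\<^bsub>M\<^esub> x"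
  by (simp_all add: restrict_scalars_def)

section \<open>Modules over \<open>um\<close> and their tensor products\<close>

locale um_module = left_module um M
  for M :: "('k::field um, 'm, 'y) module_scheme" (structure)
begin

lemma smult_scale:
  assumes "u \<in> carrier um" "x \<in> carrier M"
  shows "(c \<odot>\<^bsub>um\<^esub> u) \<odot> x = (c \<odot>\<^bsub>um\<^esub> \<one>\<^bsub>um\<^esub>) \<odot> (u \<odot> x)" (is "?l = ?r")
    and "(c \<odot>\<^bsub>um\<^esub> u) \<odot> x = u \<odot> ((c \<odot>\<^bsub>um\<^esub> \<one>\<^bsub>um\<^esub>) \<odot> x)" (is "_ = ?r'")
proof -
  have "?r = ((c \<odot>\<^bsub>um\<^esub> \<one>\<^bsub>um\<^esub>) \<otimes>\<^bsub>um\<^esub> u) \<odot> x" "?r' = (u \<otimes>\<^bsub>um\<^esub> (c \<odot>\<^bsub>um\<^esub> \<one>\<^bsub>um\<^esub>)) \<odot> x"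
    using assms by (simp_all add: smult_assoc)
  then show "?l = ?r" "?l = ?r'"
    using assms by (simp_all add: um.scale_mult_left um.scale_mult_right)
qed

lemma smult_zero_left: "x \<in> carrier M \<Longrightarrow> \<zero>\<^bsub>um\<^esub> \<odot> x = \<zero>"
  using smult_l_distr [of "\<zero>\<^bsub>um\<^esub>" "\<zero>\<^bsub>um\<^esub>" x] smult_closed [of "\<zero>\<^bsub>um\<^esub>" x] by simp

lemma vspace_restrict_scalars: "vspace (restrict_scalars um M)"
  by (rule vspaceI)
    (auto simp: um.scale_l_distr um.scale_assoc a_assoc smult_closed smult_l_distr smult_r_distr
      smult_one smult_scale(1) [of "c \<odot>\<^bsub>um\<^esub> \<one>\<^bsub>um\<^esub>" for c]
      smult_zero_left intro: a_comm)

lemma bilinear_smult: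
  "bilinear_map um (restrict_scalars um M) (restrict_scalars um M) (smult M)"
proof -
  have comm: "u \<odot> ((c \<odot>\<^bsub>um\<^esub> \<one>\<^bsub>um\<^esub>) \<odot> x) = (c \<odot>\<^bsub>um\<^esub> \<one>\<^bsub>um\<^esub>) \<odot> (u \<odot> x)"
    if "u \<in> carrier um" "x \<in> carrier M" for c u x
    using smult_scale [OF that, of c] by metis
  then show ?thesis
    unfolding bilinear_map_def restrict_scalars_fields
    by (intro conjI ballI allI)
      (rule smult_closed smult_l_distr smult_r_distr smult_scale(1) comm; assumption)+
qed

end

lemma um_tensor_fields [simp]:
  "carrier (um_tensor V W) = carrier (tensor_space (restrict_scalars um V) (restrict_scalars um W))"
  "\<zero>\<^bsub>um_tensor V W\<^esub> = \<zero>\<^bsub>tensor_space (restrict_scalars um V) (restrict_scalars um W)\<^esub>"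
  "add (um_tensor V W) = add (tensor_space (restrict_scalars um V) (restrict_scalars um W))"
  "smult (um_tensor V W) = (\<lambda>u. tensor_act (restrict_scalars um V) (restrict_scalars um W)
    (smult V) (smult W) (um_comult u))"
  by (simp_all add: um_tensor_def Let_def)

locale um_module_pair = V: um_module V + W: um_module W
  for V :: "('k::field um, 'v, 'y) module_scheme" and W :: "('k::field um, 'w, 'z) module_scheme" +
  assumes char: "CHAR('k) = 2"
begin

abbreviation "act \<equiv> tensor_act (restrict_scalars um V) (restrict_scalars um W) (smult V) (smult W)"

sublocale T: vspace "tensor_space (restrict_scalars um V) (restrict_scalars um W)"
  by (rule vspace_tensor)

lemma act_class:
  assumes "Poly_Mapping.keys f \<subseteq> carrier um \<times> carrier um"
    and "Poly_Mapping.keys g \<subseteq> carrier V \<times> carrier W"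
  shows "act (tensor_class um um f) (tensor_class (restrict_scalars um V) (restrict_scalars um W) g) =
    tensor_class (restrict_scalars um V) (restrict_scalars um W) (tensor_rep (smult V) (smult W) f g)"
  using assms
  by (intro tensor_act_class um.vspace_axioms V.vspace_restrict_scalars W.vspace_restrict_scalars
      V.bilinear_smult W.bilinear_smult) simp_all

lemma keys_act:
  assumes "Poly_Mapping.keys f \<subseteq> carrier um \<times> carrier um"
    and "Poly_Mapping.keys g \<subseteq> carrier V \<times> carrier W"
  shows "Poly_Mapping.keys (tensor_rep (smult V) (smult W) f g) \<subseteq> carrier V \<times> carrier W"
  using keys_tensor_rep [OF V.bilinear_smult W.bilinear_smult, of f g] assms by simp

sublocale C: um_rep "tensor_algebra (um :: ('k, 'k um) module) um" um_coprod
  by (rule um_rep_coprod [OF char])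

lemmas comult_closed = C.quot_extend_closed [folded um_comult_def, unfolded tensor_algebra_fields]
lemmas comult_one = C.quot_extend_one [folded um_comult_def, unfolded tensor_algebra_fields]
lemmas comult_add = C.quot_extend_add [folded um_comult_def, unfolded tensor_algebra_fields]
lemmas comult_mult = C.quot_extend_mult [folded um_comult_def]
lemmas comult_scale = C.quot_extend_scale [folded um_comult_def, unfolded tensor_algebra_fields]
lemmas comult_gen = C.quot_extend_gen [folded um_comult_def, unfolded tensor_algebra_fields]

lemma left_module_um_tensor: "left_module um (um_tensor V W)"
proof (intro left_module.intro left_module_axioms.intro um.ring_axioms)
  have "\<exists>y\<in>carrier (um_tensor V W). y \<oplus>\<^bsub>um_tensor V W\<^esub> x = \<zero>\<^bsub>um_tensor V W\<^esub>"
    if "x \<in> carrier (um_tensor V W)" for x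
    using that T.l_neg T.a_inv_closed by auto
  then show "abelian_group (um_tensor V W)"
    by (intro abelian_groupI) (simp_all add: T.a_ac)
  fix r s :: "'k um" and x y
  assume "x \<in> carrier (um_tensor V W)"
  then obtain f where f: "Poly_Mapping.keys f \<subseteq> carrier V \<times> carrier W"
    and x: "x = tensor_class (restrict_scalars um V) (restrict_scalars um W) f"
    by (auto simp: tensor_carrier)
  have "tensor_rep (smult V) (smult W) (Poly_Mapping.single (\<one>\<^bsub>um\<^esub>, \<one>\<^bsub>um\<^esub>) 1) f = f"
    using f
    by (induction rule: pm_induct) (auto simp: tensor_rep_linear V.smult_one W.smult_one)
  then show "\<one>\<^bsub>um\<^esub> \<odot>\<^bsub>um_tensor V W\<^esub> x = x"
    using f by (simp add: comult_one x pure_tensor_def act_class)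
  assume r: "r \<in> carrier um"
  then have "um_comult r \<in> carrier (tensor_space um um)"
    by (rule comult_closed)
  then obtain p where p: "Poly_Mapping.keys p \<subseteq> carrier um \<times> carrier um"
    and rp: "um_comult r = tensor_class um um p"
    by (auto simp: tensor_carrier)
  show "r \<odot>\<^bsub>um_tensor V W\<^esub> x \<in> carrier (um_tensor V W)"
    using f p by (simp add: x rp act_class tensor_carrier keys_act)
  {
    assume "y \<in> carrier (um_tensor V W)"
    then obtain g where g: "Poly_Mapping.keys g \<subseteq> carrier V \<times> carrier W"
      and y: "y = tensor_class (restrict_scalars um V) (restrict_scalars um W) g"
      by (auto simp: tensor_carrier)
    show "r \<odot>\<^bsub>um_tensor V W\<^esub> (x \<oplus>\<^bsub>um_tensor V W\<^esub> y) =
        r \<odot>\<^bsub>um_tensor V W\<^esub> x \<oplus>\<^bsub>um_tensor V W\<^esub> r \<odot>\<^bsub>um_tensor V W\<^esub> y"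
      using f g p by (simp add: x y rp act_class tensor_add keys_add_subset tensor_rep_linear)
  }
  assume s: "s \<in> carrier um"
  then have "um_comult s \<in> carrier (tensor_space um um)"
    by (rule comult_closed)
  then obtain q where q: "Poly_Mapping.keys q \<subseteq> carrier um \<times> carrier um"
    and sq: "um_comult s = tensor_class um um q"
    by (auto simp: tensor_carrier)
  have "um_comult (r \<oplus>\<^bsub>um\<^esub> s) = tensor_class um um (p + q)"
    using comult_add [OF r s] rp sq by (simp add: tensor_add)
  then show "(r \<oplus>\<^bsub>um\<^esub> s) \<odot>\<^bsub>um_tensor V W\<^esub> x =
      r \<odot>\<^bsub>um_tensor V W\<^esub> x \<oplus>\<^bsub>um_tensor V W\<^esub> s \<odot>\<^bsub>um_tensor V W\<^esub> x"
    using f p q by (simp add: x rp sq act_class tensor_add keys_add_subset tensor_rep_linear)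
  \<comment> \<open>Associativity of the action is multiplicativity of the comultiplication, read on
    representatives.\<close>
  have "um_comult (r \<otimes>\<^bsub>um\<^esub> s) = tensor_class um um (tensor_rep (mult um) (mult um) p q)"
    using comult_mult [OF r s] rp sq p q
    by (simp add: tensor_algebra_mult k_algebra_um)
  moreover have "Poly_Mapping.keys (tensor_rep (mult um) (mult um) p q) \<subseteq> carrier um \<times> carrier um"
    using keys_tensor_rep [OF k_algebra_bilinear_mult k_algebra_bilinear_mult, OF k_algebra_um k_algebra_um p q]
    by simp
  ultimately show "(r \<otimes>\<^bsub>um\<^esub> s) \<odot>\<^bsub>um_tensor V W\<^esub> x =
      r \<odot>\<^bsub>um_tensor V W\<^esub> (s \<odot>\<^bsub>um_tensor V W\<^esub> x)"
    using f p q
    by (simp add: x rp sq act_class keys_act V.smult_assoc W.smult_assoc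
        tensor_rep_assoc [where A = um and B = um and V = V and W = W])
qed

lemma um_tensor_gen:
  assumes "Poly_Mapping.keys g \<subseteq> carrier V \<times> carrier W"
  shows "um_gen_elem x \<odot>\<^bsub>um_tensor V W\<^esub> tensor_class (restrict_scalars um V) (restrict_scalars um W) g =
    tensor_class (restrict_scalars um V) (restrict_scalars um W)
      (tensor_rep (smult V) (smult W)
        (Poly_Mapping.single (um_gen_elem x, \<one>\<^bsub>um\<^esub>) 1 + Poly_Mapping.single (\<one>\<^bsub>um\<^esub>, um_gen_elem x) 1) g)"
  using assms
  by (simp add: comult_gen pure_tensor_def tensor_add act_class keys_add_subset)

text \<open>The comultiplication sends a scalar c to c (1 \<otimes> 1), so scalars acting through
  the unit of \<open>um\<close> agree with those of the underlying tensor space.\<close>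

lemma um_tensor_scalar:
  assumes "Poly_Mapping.keys g \<subseteq> carrier V \<times> carrier W"
  shows "(c \<odot>\<^bsub>um\<^esub> \<one>\<^bsub>um\<^esub>) \<odot>\<^bsub>um_tensor V W\<^esub> tensor_class (restrict_scalars um V) (restrict_scalars um W) g =
    tensor_class (restrict_scalars um V) (restrict_scalars um W) (scale_pm c g)"
proof -
  have "tensor_rep (smult V) (smult W) (Poly_Mapping.single (\<one>\<^bsub>um\<^esub>, \<one>\<^bsub>um\<^esub>) c) g = scale_pm c g"
    using assms
    by (induction rule: pm_induct)
      (auto simp: tensor_rep_linear V.smult_one W.smult_one pm.scale_right_distrib mult.commute)
  then show ?thesis
    using assms
    by (simp add: comult_scale comult_one pure_tensor_def tensor_smult act_class)
qed

end

section \<open>The modules \<open>V\<^sub>0\<close> and \<open>V\<^sub>1\<close>\<close>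

lemma k_algebra_field: "k_algebra (field_algebra :: ('k::field, 'k) module)"
  by (intro k_algebraI vspaceI) (simp_all add: field_algebra_def algebra_simps)

lemma um_rep_counit: "um_rep (field_algebra :: ('k::field, 'k) module) (\<lambda>_. 0)"
  by (intro um_rep.intro um_rep_axioms.intro k_algebra_field) (simp_all add: field_algebra_def)

lemma left_module_V0: "left_module (um :: ('k::field, 'k um) module) V0"
proof -
  interpret um_rep "field_algebra :: ('k, 'k) module" "\<lambda>_. 0" by (rule um_rep_counit)
  have ops: "mult field_algebra = ((*) :: 'k \<Rightarrow> _)" "add field_algebra = ((+) :: 'k \<Rightarrow> _)"
    "\<one>\<^bsub>field_algebra\<^esub> = (1 :: 'k)"
    by (simp_all add: field_algebra_def)
  note hom = quot_extend_add quot_extend_mult quot_extend_one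
  show ?thesis
    by (intro left_module.intro left_module_axioms.intro um.ring_axioms abelian_groupI)
      (auto simp: V0_def um_counit_def hom ops algebra_simps intro: exI [of _ "- x" for x])
qed

lemma k_algebra_matrix: "k_algebra (matrix_algebra :: ('k::field, 'k ^ 'n::finite ^ 'n) module)"
  by (intro k_algebraI vspaceI)
    (simp_all add: matrix_algebra_def matrix_mul_assoc,
      simp_all add: vec_eq_iff matrix_matrix_mult_def algebra_simps sum_distrib_left sum.distrib)

text \<open>The relations are matrix identities modulo 2: for instance ab + ba has middle diagonal
  entry 2 where c has 0, and c^2 + c is 2c.\<close>

lemma um_rep_V1:
  assumes "CHAR('k::field) = 2"
  shows "um_rep (matrix_algebra :: ('k, 'k ^ 3 ^ 3) module) V1_matrix"
proof -
  have "(1 + 1 :: 'k) = 0"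
    using of_nat_CHAR [where 'a = 'k] assms by simp
  then show ?thesis
    by (intro um_rep.intro um_rep_axioms.intro k_algebra_matrix)
      (simp_all add: matrix_algebra_def vec_eq_iff forall_3 matrix_matrix_mult_def sum_3 vector_3)
qed

abbreviation V1_rep :: "'k::field um \<Rightarrow> 'k ^ 3 ^ 3"
  where "V1_rep \<equiv> quot_extend matrix_algebra V1_matrix"

context
  assumes char: "CHAR('k::field) = 2"
begin

interpretation V1: um_rep "matrix_algebra :: ('k, 'k ^ 3 ^ 3) module" V1_matrix
  by (rule um_rep_V1 [OF char])

lemma V1_rep_simps:
  fixes u v :: "'k um"
  shows "V1_rep (\<one>\<^bsub>um\<^esub> :: 'k um) = mat 1"
    and "V1_rep (um_gen_elem x :: 'k um) = V1_matrix x"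
    and "\<lbrakk>u \<in> carrier um; v \<in> carrier um\<rbrakk> \<Longrightarrow> V1_rep (u \<oplus>\<^bsub>um\<^esub> v) = V1_rep u + V1_rep v"
    and "\<lbrakk>u \<in> carrier um; v \<in> carrier um\<rbrakk> \<Longrightarrow> V1_rep (u \<otimes>\<^bsub>um\<^esub> v) = V1_rep u ** V1_rep v"
    and "u \<in> carrier um \<Longrightarrow> V1_rep (c \<odot>\<^bsub>um\<^esub> u) = (\<chi> i j. c * V1_rep u $ i $ j)"
  using V1.quot_extend_one V1.quot_extend_gen [of x] V1.quot_extend_add [of u v]
    V1.quot_extend_mult [of u v] V1.quot_extend_scale [of u c]
  by (simp_all add: matrix_algebra_def)

lemma V1_scalar: "V1_rep (c \<odot>\<^bsub>um\<^esub> \<one>\<^bsub>um\<^esub>) *v v = c *s (v :: 'k ^ 3)"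
proof -
  have "(\<chi> i j. c * mat 1 $ i $ j) *v v = c *s (mat 1 *v v)"
    by (simp add: vec_eq_iff matrix_vector_mult_def sum_distrib_left mult.assoc)
  then show ?thesis by (simp add: V1_rep_simps)
qed

lemma left_module_V1: "left_module (um :: ('k, 'k um) module) V1"
  by (intro left_module.intro left_module_axioms.intro um.ring_axioms abelian_groupI)
    (auto simp: V1_def V1_rep_simps matrix_vector_right_distrib matrix_vector_mult_add_rdistrib
      matrix_vector_mul_assoc intro: exI [of _ "- x" for x])

end

section \<open>The submodule generated by a vector of weight one killed by \<open>a\<^sup>2\<close>\<close>

context um_module
begin

definition sc :: "'k \<Rightarrow> 'm \<Rightarrow> 'm" where "sc c x = (c \<odot>\<^bsub>um\<^esub> \<one>\<^bsub>um\<^esub>) \<odot> x"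

abbreviation ga :: "'m \<Rightarrow> 'm" where "ga x \<equiv> um_gen_elem Gen_a \<odot> x"
abbreviation gb :: "'m \<Rightarrow> 'm" where "gb x \<equiv> um_gen_elem Gen_b \<odot> x"
abbreviation gc :: "'m \<Rightarrow> 'm" where "gc x \<equiv> um_gen_elem Gen_c \<odot> x"

interpretation K: vspace "restrict_scalars um M"
  by (rule vspace_restrict_scalars)

lemma sc_simps:
  assumes "x \<in> carrier M"
  shows "sc c x \<in> carrier M" "sc (c + d) x = sc c x \<oplus> sc d x"
    "y \<in> carrier M \<Longrightarrow> sc c (x \<oplus> y) = sc c x \<oplus> sc c y"
    "sc (c * d) x = sc c (sc d x)" "sc 1 x = x" "sc 0 x = \<zero>"
  using assms K.scale_closed [of x c] K.scale_l_distr [of x c d] K.scale_r_distr [of x y c]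
    K.scale_assoc [of x c d] K.scale_one [of x] K.scale_zero_left [of x]
  by (simp_all add: sc_def)

lemma sc_zero [simp]: "sc c \<zero> = \<zero>"
  using K.scale_zero_right [of c] by (simp add: sc_def)

lemma smult_sc: "\<lbrakk>u \<in> carrier um; x \<in> carrier M\<rbrakk> \<Longrightarrow> u \<odot> sc c x = sc c (u \<odot> x)"
  using smult_scale [of u x c] by (simp add: sc_def)

lemma smult_zero_right: "u \<in> carrier um \<Longrightarrow> u \<odot> \<zero> = \<zero>"
  using smult_r_distr [of u \<zero> \<zero>] smult_closed [of u \<zero>] by simp

lemma double_zero: "\<lbrakk>CHAR('k) = 2; x \<in> carrier M\<rbrakk> \<Longrightarrow> x \<oplus> x = \<zero>"
  using K.double_eq_zero [of x] by simp

text \<open>Keeping the coefficients of the b^i y and b^i a y as arguments turns the action of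
  \<open>um\<close> into operations on scalars, as in \<open>lc_action\<close>. Nothing is claimed
  here about independence of the eight elements.\<close>

definition lc :: "'m \<Rightarrow> 'k \<Rightarrow> 'k \<Rightarrow> 'k \<Rightarrow> 'k \<Rightarrow> 'k \<Rightarrow> 'k \<Rightarrow> 'k \<Rightarrow> 'k \<Rightarrow> 'm"
  where "lc y c0 c1 c2 c3 d0 d1 d2 d3 =
    sc c0 y \<oplus> (sc c1 (gb y) \<oplus> (sc c2 (gb (gb y)) \<oplus> (sc c3 (gb (gb (gb y))) \<oplus>
    (sc d0 (ga y) \<oplus> (sc d1 (gb (ga y)) \<oplus> (sc d2 (gb (gb (ga y))) \<oplus> sc d3 (gb (gb (gb (ga y))))))))))"

lemma lc_closed [simp]: "y \<in> carrier M \<Longrightarrow> lc y c0 c1 c2 c3 d0 d1 d2 d3 \<in> carrier M"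
  by (simp add: lc_def sc_simps smult_closed)

lemma lc_add:
  "y \<in> carrier M \<Longrightarrow> lc y c0 c1 c2 c3 d0 d1 d2 d3 \<oplus> lc y c0' c1' c2' c3' d0' d1' d2' d3' =
    lc y (c0 + c0') (c1 + c1') (c2 + c2') (c3 + c3') (d0 + d0') (d1 + d1') (d2 + d2') (d3 + d3')"
  by (simp add: lc_def sc_simps smult_closed a_ac)

lemma sc_lc:
  "y \<in> carrier M \<Longrightarrow> sc k (lc y c0 c1 c2 c3 d0 d1 d2 d3) =
    lc y (k * c0) (k * c1) (k * c2) (k * c3) (k * d0) (k * d1) (k * d2) (k * d3)"
  by (simp add: lc_def sc_simps smult_closed)

text \<open>The equations are oriented as rewrite rules that move b to the left and c to the right,
  so that words reach the order b, a, c. \<open>basis_action\<close> is the result of running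
  them.\<close>

lemma commutation:
  assumes char: "CHAR('k) = 2" and x: "x \<in> carrier M"
  shows "ga (gb x) = gb (ga x) \<oplus> gc x" and "gc (ga x) = ga (gc x) \<oplus> ga x"
    and "gc (gb x) = gb (gc x) \<oplus> gb x" and "gb (gb (gb (gb x))) = \<zero>"
proof -
  \<comment> \<open>In characteristic 2 a summand changes sides without a sign.\<close>
  have move: "u = v \<oplus> w" if "u \<oplus> v = w" "u \<in> carrier M" "v \<in> carrier M" for u v w
    using that double_zero [OF char, of v] by (metis a_assoc a_comm r_zero)
  have move': "v = u \<oplus> w" if "u \<oplus> v = w" "u \<in> carrier M" "v \<in> carrier M" for u v w
    using that move a_comm by metis
  show "ga (gb x) = gb (ga x) \<oplus> gc x"
    by (rule move) (use x in \<open>simp_all add: smult_closed flip: smult_assoc smult_l_distr um_relations(1)\<close>)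
  show "gc (ga x) = ga (gc x) \<oplus> ga x"
    by (rule move') (use x in \<open>simp_all add: smult_closed um_relations(2) flip: smult_assoc smult_l_distr\<close>)
  show "gc (gb x) = gb (gc x) \<oplus> gb x"
    by (rule move') (use x in \<open>simp_all add: smult_closed um_relations(3) flip: smult_assoc smult_l_distr\<close>)
  have "gb (gb (gb (gb x))) = ((um_gen_elem Gen_b \<otimes>\<^bsub>um\<^esub> um_gen_elem Gen_b) \<otimes>\<^bsub>um\<^esub>
      (um_gen_elem Gen_b \<otimes>\<^bsub>um\<^esub> um_gen_elem Gen_b)) \<odot> x"
    using x by (simp add: smult_assoc smult_closed)
  then show "gb (gb (gb (gb x))) = \<zero>"
    using x by (simp only: um_relations(5) smult_zero_left)
qed

end

text \<open>The model is v2 \<otimes> v3: c fixes it, a sends it to v3 \<otimes> v3, and a^2 kills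
  it. The two conditions make the span of the eight elements stable under the generators.\<close>

locale um_vector = um_module M
  for M :: "('k::field um, 'm, 'y) module_scheme" (structure) +
  fixes y :: 'm
  assumes char: "CHAR('k) = 2"
    and y_closed [simp]: "y \<in> carrier M"
    and y_weight: "gc y = y"
    and y_kill: "ga (ga y) = \<zero>"
begin

lemma double_left: "\<lbrakk>u \<in> carrier M; v \<in> carrier M\<rbrakk> \<Longrightarrow> u \<oplus> (u \<oplus> v) = v"
  using double_zero [OF char, of u] by (simp flip: a_assoc)

text \<open>Each a or b shifts the weight under c by one, so c acts as 1 or 0 according to the
  parity of the word. Moving a past b^i produces the lower terms, and a^2 y = 0 removes the leading
  term of a b^i a y.\<close>

lemma basis_action:
  "gc (gb y) = \<zero>" "gc (gb (gb y)) = gb (gb y)" "gc (gb (gb (gb y))) = \<zero>"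
  "gc (ga y) = \<zero>" "gc (gb (ga y)) = gb (ga y)" "gc (gb (gb (ga y))) = \<zero>"
  "gc (gb (gb (gb (ga y)))) = gb (gb (gb (ga y)))"
  "ga (gb y) = gb (ga y) \<oplus> y" "ga (gb (gb y)) = gb (gb (ga y)) \<oplus> gb y"
  "ga (gb (gb (gb y))) = gb (gb (gb (ga y)))"
  "ga (gb (ga y)) = \<zero>" "ga (gb (gb (ga y))) = gb (ga y)"
  "ga (gb (gb (gb (ga y)))) = gb (gb (ga y))"
  "gb (gb (gb (gb y))) = \<zero>" "gb (gb (gb (gb (ga y)))) = \<zero>"
  by (simp_all add: commutation [OF char] smult_closed y_weight y_kill double_zero [OF char]
      smult_zero_right smult_r_distr double_left a_assoc)

lemma lc_action:
  "gb (lc y c0 c1 c2 c3 d0 d1 d2 d3) = lc y 0 c0 c1 c2 0 d0 d1 d2"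
  "gc (lc y c0 c1 c2 c3 d0 d1 d2 d3) = lc y c0 0 c2 0 0 d1 0 d3"
  "ga (lc y c0 c1 c2 c3 d0 d1 d2 d3) = lc y c1 c2 0 0 c0 (c1 + d2) (c2 + d3) c3"
  by (simp_all add: lc_def smult_r_distr smult_closed smult_sc sc_simps y_weight y_kill basis_action a_ac)

end

section \<open>Coordinates on \<open>V\<^sub>1 \<otimes> V\<^sub>1\<close>\<close>

definition outer :: "'k::field ^ 'n \<Rightarrow> 'k ^ 'm \<Rightarrow> 'k ^ 'm ^ 'n"
  where "outer v w = (\<chi> i j. v $ i * w $ j)"

text \<open>The linear map with v \<otimes> w sent to the matrix of rank at most one v w^T. It
  becomes a complete invariant of the class in \<open>tensor_class_eq_iff_coord\<close>.\<close>

definition coord :: "(('k::field ^ 'n) \<times> ('k ^ 'm) \<Rightarrow>\<^sub>0 'k) \<Rightarrow> 'k ^ 'm ^ 'n"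
  where "coord f = (\<Sum>x\<in>Poly_Mapping.keys f. \<chi> i j. Poly_Mapping.lookup f x * outer (fst x) (snd x) $ i $ j)"

lemma coord_nth:
  assumes "finite X" "Poly_Mapping.keys f \<subseteq> X"
  shows "coord f $ i $ j = (\<Sum>x\<in>X. Poly_Mapping.lookup f x * outer (fst x) (snd x) $ i $ j)"
  unfolding coord_def sum_component
  by (subst sum.mono_neutral_left [of X]) (use assms in \<open>auto simp: in_keys_iff\<close>)

lemma coord_single: "coord (Poly_Mapping.single (v, w) c) = (\<chi> i j. c * outer v w $ i $ j)"
  by (simp add: vec_eq_iff coord_nth [of "{(v, w)}"])

lemma coord_add: "coord (f + g) = coord f + coord g"
proof -
  let ?X = "Poly_Mapping.keys f \<union> Poly_Mapping.keys g"
  have "Poly_Mapping.keys (f + g) \<subseteq> ?X" by (rule Poly_Mapping.keys_add)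
  then show ?thesis
    by (simp add: vec_eq_iff coord_nth [of ?X] lookup_add distrib_right sum.distrib)
qed

lemma coord_scale: "coord (scale_pm c f) = (\<chi> i j. c * coord f $ i $ j)"
  using keys_scale_pm [of c f]
  by (simp add: vec_eq_iff coord_nth [of "Poly_Mapping.keys f"] sum_distrib_left mult.assoc)

lemma coord_diff: "coord (f - g) = coord f - coord g"
  using coord_add [of "f - g" g] by (simp add: eq_diff_eq)

definition mat_tensor :: "'k::field ^ 'm ^ 'n \<Rightarrow> (('k ^ 'n) \<times> ('k ^ 'm) \<Rightarrow>\<^sub>0 'k)"
  where "mat_tensor m = (\<Sum>i\<in>UNIV. \<Sum>j\<in>UNIV. Poly_Mapping.single (axis i 1, axis j 1) (m $ i $ j))"

lemma coord_sum: "coord (\<Sum>i\<in>I. f i) = (\<Sum>i\<in>I. coord (f i))"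
proof (induction I rule: infinite_finite_induct)
  case empty
  then show ?case by (simp add: coord_def)
next
  case (infinite I)
  then show ?case by (simp add: coord_def)
qed (simp add: coord_add)

lemma coord_mat_tensor: "coord (mat_tensor m) = m"
proof -
  have "(\<Sum>p\<in>UNIV. \<Sum>q\<in>UNIV. m $ p $ q * outer (axis p 1) (axis q 1) $ i $ j) = m $ i $ j" for i j
  proof -
    have "(\<Sum>q\<in>UNIV. m $ p $ q * outer (axis p 1) (axis q 1) $ i $ j) = (if p = i then m $ p $ j else 0)" for p
      by (auto simp: outer_def axis_def if_distrib [of "(*) _"] cong: if_cong)
    then show ?thesis by simp
  qed
  then show ?thesis
    by (simp add: mat_tensor_def coord_sum coord_single vec_eq_iff)
qed

locale vec_spaces =
  fixes V :: "('k::field, 'k ^ 'n, 'x) module_scheme" and W :: "('k::field, 'k ^ 'm, 'y) module_scheme"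
  assumes V: "carrier V = UNIV" "add V = (+)" "\<And>c v. c \<odot>\<^bsub>V\<^esub> v = c *s v"
    and W: "carrier W = UNIV" "add W = (+)" "\<And>c w. c \<odot>\<^bsub>W\<^esub> w = c *s w"
begin

lemma coord_relators:
  assumes "n \<in> pm.span (tensor_relators V W)"
  shows "coord n = 0"
  using assms
proof (induction rule: pm.span_induct_alt)
  case base
  then show ?case by (simp add: coord_def)
next
  case (step c x y)
  from step(1) have "coord x = 0"
    by (cases rule: tensor_relators_cases)
      (simp_all add: coord_diff coord_single outer_def V W vec_eq_iff distrib_left distrib_right ac_simps)
  then show ?case using step by (simp add: coord_add coord_scale vec_eq_iff)
qed

lemma tensor_class_congs:
  "tensor_class V W (Poly_Mapping.single (v + v', w) 1) =
    tensor_class V W (Poly_Mapping.single (v, w) 1 + Poly_Mapping.single (v', w) 1)"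
  "tensor_class V W (Poly_Mapping.single (v, w + w') 1) =
    tensor_class V W (Poly_Mapping.single (v, w) 1 + Poly_Mapping.single (v, w') 1)"
  "tensor_class V W (Poly_Mapping.single (c *s v, w) 1) = tensor_class V W (Poly_Mapping.single (v, w) c)"
  "tensor_class V W (Poly_Mapping.single (v, c *s w) 1) = tensor_class V W (Poly_Mapping.single (v, w) c)"
  using tensor_relators_memI(1) [of v V v' w W] tensor_relators_memI(2) [of v V w W w']
    tensor_relators_memI(3) [of v V w W c] tensor_relators_memI(4) [of v V w W c]
  by (simp_all add: tensor_class_eq_iff V W diff_diff_eq)

lemma tensor_class_add_cong:
  "\<lbrakk>tensor_class V W f = tensor_class V W f'; tensor_class V W g = tensor_class V W g'\<rbrakk> \<Longrightarrow>
    tensor_class V W (f + g) = tensor_class V W (f' + g')"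
  by (simp flip: tensor_add)

lemma tensor_class_scale_cong:
  "tensor_class V W f = tensor_class V W f' \<Longrightarrow>
    tensor_class V W (scale_pm c f) = tensor_class V W (scale_pm c f')"
  by (simp flip: tensor_smult)

lemma tensor_class_zero:
  "tensor_class V W (Poly_Mapping.single (0, w) 1) = tensor_class V W 0"
  "tensor_class V W (Poly_Mapping.single (v, 0) 1) = tensor_class V W 0"
  using tensor_class_congs(3) [of 0 0 w] tensor_class_congs(4) [of v 0 0] by simp_all

lemma tensor_class_sum_cong:
  "(\<And>i. i \<in> I \<Longrightarrow> tensor_class V W (f i) = tensor_class V W (g i)) \<Longrightarrow>
    tensor_class V W (\<Sum>i\<in>I. f i) = tensor_class V W (\<Sum>i\<in>I. g i)"
proof (induction I rule: infinite_finite_induct)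
  case (insert i I)
  then show ?case
    using tensor_class_add_cong [of "f i" "g i" "\<Sum>i\<in>I. f i" "\<Sum>i\<in>I. g i"] by simp
qed simp_all

lemma tensor_class_sum_left:
  "tensor_class V W (Poly_Mapping.single (\<Sum>i\<in>I. c i *s v i, w) 1) =
    tensor_class V W (\<Sum>i\<in>I. Poly_Mapping.single (v i, w) (c i))"
proof (induction I rule: infinite_finite_induct)
  case (insert i I)
  then show ?case
    using tensor_class_add_cong [OF tensor_class_congs(3) insert.IH] by (simp add: tensor_class_congs(1))
qed (simp_all add: tensor_class_zero)

lemma tensor_class_sum_right:
  "tensor_class V W (Poly_Mapping.single (v, \<Sum>i\<in>I. c i *s w i) 1) =
    tensor_class V W (\<Sum>i\<in>I. Poly_Mapping.single (v, w i) (c i))"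
proof (induction I rule: infinite_finite_induct)
  case (insert i I)
  then show ?case
    using tensor_class_add_cong [OF tensor_class_congs(4) insert.IH] by (simp add: tensor_class_congs(2))
qed (simp_all add: tensor_class_zero)

text \<open>Modulo the relators, both vectors of a pair can be expanded in the standard basis. This
  is the spanning half of the basis of the tensor product; \<open>coord_relators\<close> is the
  independence half.\<close>

lemma tensor_class_coord: "tensor_class V W f = tensor_class V W (mat_tensor (coord f))"
proof -
  have class_single: "tensor_class V W (Poly_Mapping.single (v, w) 1) = tensor_class V W (mat_tensor (outer v w))"
    for v w
  proof -
    have "tensor_class V W (Poly_Mapping.single (axis i 1, w) (v $ i)) =
        tensor_class V W (\<Sum>j\<in>UNIV. Poly_Mapping.single (axis i 1, axis j 1) (v $ i * w $ j))" for i
    proof -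
      have "tensor_class V W (scale_pm (v $ i) (Poly_Mapping.single (axis i 1, w) 1)) =
          tensor_class V W (scale_pm (v $ i) (\<Sum>j\<in>UNIV. Poly_Mapping.single (axis i 1, axis j 1) (w $ j)))"
        by (rule tensor_class_scale_cong)
          (use tensor_class_sum_right [of "axis i 1" "\<lambda>j. w $ j" "\<lambda>j. axis j 1" UNIV]
            in \<open>simp add: basis_expansion\<close>)
      then show ?thesis by (simp add: pm.scale_sum_right)
    qed
    then show ?thesis
      using tensor_class_sum_left [of "\<lambda>i. v $ i" "\<lambda>i. axis i 1" UNIV w]
        tensor_class_sum_cong [of UNIV "\<lambda>i. Poly_Mapping.single (axis i 1, w) (v $ i)"
          "\<lambda>i. \<Sum>j\<in>UNIV. Poly_Mapping.single (axis i 1, axis j 1) (v $ i * w $ j)"]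
      by (simp add: basis_expansion mat_tensor_def outer_def)
  qed
  have mt_add: "mat_tensor (m + m') = mat_tensor m + mat_tensor m'" for m m' :: "'k ^ 'm ^ 'n"
    by (simp add: mat_tensor_def single_add sum.distrib)
  have mt_scale: "mat_tensor (\<chi> i j. c * m $ i $ j) = scale_pm c (mat_tensor m)" for c and m :: "'k ^ 'm ^ 'n"
    by (simp add: mat_tensor_def pm.scale_sum_right)
  have "Poly_Mapping.keys f \<subseteq> UNIV" by simp
  then show ?thesis
  proof (induction rule: pm_induct)
    case zero
    then show ?case by (simp add: coord_def mat_tensor_def)
  next
    case (single x)
    obtain v w where "x = (v, w)" by (rule prod.exhaust)
    moreover have "(\<chi> i j. outer v w $ i $ j) = outer v w" by (simp add: vec_eq_iff)
    ultimately show ?case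
      using class_single [of v w] by (simp add: coord_single)
  next
    case (add f g)
    then show ?case
      unfolding coord_add mt_add by (rule tensor_class_add_cong)
  next
    case (scale c f)
    then show ?case
      unfolding coord_scale mt_scale by (rule tensor_class_scale_cong)
  qed
qed

lemma tensor_class_eq_iff_coord: "tensor_class V W f = tensor_class V W g \<longleftrightarrow> coord f = coord g"
proof
  assume "tensor_class V W f = tensor_class V W g"
  then have "coord (f - g) = 0"
    by (intro coord_relators) (simp add: tensor_class_eq_iff)
  then show "coord f = coord g" by (simp add: coord_diff)
qed (metis tensor_class_coord)

end

section \<open>Homomorphisms of \<open>\<uu>(\<mm>)\<close>-modules\<close>

text \<open>The elements of \<open>um\<close> whose action commutes with \<open>h\<close> contain
  the unit and are closed under sums, scalars and left multiplication by generators, so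
  \<open>um_induct\<close> applies.\<close>

lemma um_mod_homI:
  fixes M :: "('k::field um, 'm, 'y) module_scheme" and N :: "('k um, 'n, 'z) module_scheme"
  assumes M: "left_module um M" and N: "left_module um N"
    and closed: "\<And>x. x \<in> carrier M \<Longrightarrow> h x \<in> carrier N"
    and add: "\<And>x y. \<lbrakk>x \<in> carrier M; y \<in> carrier M\<rbrakk> \<Longrightarrow> h (x \<oplus>\<^bsub>M\<^esub> y) = h x \<oplus>\<^bsub>N\<^esub> h y"
    and scalar: "\<And>c x. x \<in> carrier M \<Longrightarrow>
      h ((c \<odot>\<^bsub>um\<^esub> \<one>\<^bsub>um\<^esub>) \<odot>\<^bsub>M\<^esub> x) = (c \<odot>\<^bsub>um\<^esub> \<one>\<^bsub>um\<^esub>) \<odot>\<^bsub>N\<^esub> h x"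
    and gen: "\<And>g x. x \<in> carrier M \<Longrightarrow> h (um_gen_elem g \<odot>\<^bsub>M\<^esub> x) = um_gen_elem g \<odot>\<^bsub>N\<^esub> h x"
  shows "h \<in> mod_hom um M N"
proof -
  interpret M: um_module M by (rule um_module.intro [OF M])
  interpret N: um_module N by (rule um_module.intro [OF N])
  have "\<forall>x\<in>carrier M. h (u \<odot>\<^bsub>M\<^esub> x) = u \<odot>\<^bsub>N\<^esub> h x" if "u \<in> carrier um" for u
    using that
  proof (induction rule: um_induct)
    case one
    then show ?case by (simp add: M.smult_one N.smult_one closed)
  next
    case (add u v)
    then show ?case
      by (simp add: M.smult_l_distr N.smult_l_distr M.smult_closed closed assms(4))
  next
    case (scale c u)
    then show ?case
      by (simp add: M.smult_scale(1) [of u] N.smult_scale(1) [of u] M.smult_closed closed scalar)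
  next
    case (gen g u)
    then show ?case
      by (simp add: M.smult_assoc N.smult_assoc M.smult_closed closed assms(6))
  qed
  then show ?thesis
    using closed add by (auto simp: mod_hom_def)
qed

lemma mod_homD:
  assumes "h \<in> mod_hom R M N"
  shows "x \<in> carrier M \<Longrightarrow> h x \<in> carrier N"
    and "\<lbrakk>x \<in> carrier M; y \<in> carrier M\<rbrakk> \<Longrightarrow> h (x \<oplus>\<^bsub>M\<^esub> y) = h x \<oplus>\<^bsub>N\<^esub> h y"
    and "\<lbrakk>r \<in> carrier R; x \<in> carrier M\<rbrakk> \<Longrightarrow> h (r \<odot>\<^bsub>M\<^esub> x) = r \<odot>\<^bsub>N\<^esub> h x"
  using assms by (auto simp: mod_hom_def)

lemma mod_hom_comp:
  "\<lbrakk>f \<in> mod_hom R M N; g \<in> mod_hom R N L\<rbrakk> \<Longrightarrow> g \<circ> f \<in> mod_hom R M L"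
  by (auto simp: mod_hom_def Pi_iff)

lemma mod_hom_zero:
  assumes "left_module R M" "left_module R N" "h \<in> mod_hom R M N"
  shows "h \<zero>\<^bsub>M\<^esub> = \<zero>\<^bsub>N\<^esub>"
proof -
  interpret M: left_module R M by (rule assms)
  interpret N: left_module R N by (rule assms)
  show ?thesis
    using mod_homD(1) [OF assms(3), of "\<zero>\<^bsub>M\<^esub>"] mod_homD(2) [OF assms(3), of "\<zero>\<^bsub>M\<^esub>" "\<zero>\<^bsub>M\<^esub>"] by simp
qed

lemma submodule_image:
  assumes M: "left_module R M" and N: "left_module R N" and h: "h \<in> mod_hom R M N"
  shows "submodule (h ` carrier M) R N"
proof -
  interpret M: left_module R M by (rule M)
  interpret N: left_module R N by (rule N)
  note [simp] = mod_homD [OF h] mod_hom_zero [OF M N h]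
  have inv: "\<ominus>\<^bsub>N\<^esub> h x = h (\<ominus>\<^bsub>M\<^esub> x)" if "x \<in> carrier M" for x
    by (rule N.minus_equality) (use that mod_homD(2) [OF h, of "\<ominus>\<^bsub>M\<^esub> x" x] in \<open>simp_all add: M.l_neg\<close>)
  show ?thesis
  proof (intro submodule.intro subgroup.intro submodule_axioms.intro)
    show "inv\<^bsub>add_monoid N\<^esub> x \<in> h ` carrier M" if "x \<in> h ` carrier M" for x
      using that by (auto simp: inv simp flip: a_inv_def)
    show "x \<otimes>\<^bsub>add_monoid N\<^esub> y \<in> h ` carrier M" if "x \<in> h ` carrier M" "y \<in> h ` carrier M" for x y
      using that by (auto simp flip: mod_homD(2) [OF h])
    show "\<one>\<^bsub>add_monoid N\<^esub> \<in> h ` carrier M"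
      using mod_hom_zero [OF M N h] by (metis M.zero_closed image_eqI monoid.select_convs(2))
    show "a \<odot>\<^bsub>N\<^esub> x \<in> h ` carrier M" if "a \<in> carrier R" "x \<in> h ` carrier M" for a x
      using that by (auto simp: M.smult_closed simp flip: mod_homD(3) [OF h])
  qed (auto)
qed

definition transport_module ::
  "('m \<Rightarrow> 'n) \<Rightarrow> ('r, 'm, 'y) module_scheme \<Rightarrow> ('r, 'n) module"
  where "transport_module \<iota> M = (let \<rho> = the_inv_into (carrier M) \<iota> in
    \<lparr>carrier = \<iota> ` carrier M, mult = undefined, one = undefined, zero = \<iota> \<zero>\<^bsub>M\<^esub>,
     add = (\<lambda>x y. \<iota> (\<rho> x \<oplus>\<^bsub>M\<^esub> \<rho> y)), smult = (\<lambda>r x. \<iota> (r \<odot>\<^bsub>M\<^esub> \<rho> x))\<rparr>)"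

text \<open>The test modules of \<open>projective_module\<close> live on a fixed type, so \<open>M\<close> first has to be moved there.\<close>

lemma projective_section:
  fixes P :: "('r, 'p, 'y) module_scheme" and M :: "('r, 'm, 'z) module_scheme"
    and \<iota> :: "'m \<Rightarrow> 'p \<Rightarrow> 'r"
  assumes P: "projective_module R P" and M: "left_module R M"
    and g: "g \<in> mod_hom R M P" "g ` carrier M = carrier P"
    and inj: "inj_on \<iota> (carrier M)"
  obtains h where "h \<in> mod_hom R P M" "\<And>x. x \<in> carrier P \<Longrightarrow> g (h x) = x"
proof -
  interpret M: left_module R M by (rule M)
  interpret P: left_module R P using P by (simp add: projective_module_def)
  let ?\<rho> = "the_inv_into (carrier M) \<iota>" and ?M = "transport_module \<iota> M"
  have \<rho> [simp]: "?\<rho> (\<iota> x) = x" if "x \<in> carrier M" for x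
    using that inj by (rule the_inv_into_f_f [rotated])
  have fields [simp]: "carrier ?M = \<iota> ` carrier M" "\<zero>\<^bsub>?M\<^esub> = \<iota> \<zero>\<^bsub>M\<^esub>"
    "x \<oplus>\<^bsub>?M\<^esub> y = \<iota> (?\<rho> x \<oplus>\<^bsub>M\<^esub> ?\<rho> y)" "r \<odot>\<^bsub>?M\<^esub> x = \<iota> (r \<odot>\<^bsub>M\<^esub> ?\<rho> x)" for x y r
    by (simp_all add: transport_module_def Let_def)
  \<comment> \<open>\<open>P\<close> may carry a record extension, whereas test modules are plain
    \<open>module\<close> records. This is \<open>P\<close> without the extension, and the map to be
    lifted is the identity.\<close>
  let ?P = "\<lparr>carrier = carrier P, mult = undefined, one = undefined, zero = \<zero>\<^bsub>P\<^esub>, add = add P, smult = smult P\<rparr>"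
  have "\<exists>y\<in>carrier ?M. y \<oplus>\<^bsub>?M\<^esub> x = \<zero>\<^bsub>?M\<^esub>" if "x \<in> carrier ?M" for x
  proof -
    from that obtain m where "m \<in> carrier M" "x = \<iota> m" by auto
    then show ?thesis
      by (intro bexI [of _ "\<iota> (\<ominus>\<^bsub>M\<^esub> m)"]) (simp_all add: M.l_neg)
  qed
  then have "abelian_group ?M"
    by (intro abelian_groupI) (auto simp: M.a_ac)
  then have M': "left_module R ?M"
    by (intro left_module.intro left_module_axioms.intro M.R.ring_axioms)
      (auto simp: M.smult_closed M.smult_l_distr M.smult_r_distr M.smult_assoc M.smult_one)
  have "\<exists>y\<in>carrier ?P. y \<oplus>\<^bsub>?P\<^esub> x = \<zero>\<^bsub>?P\<^esub>" if "x \<in> carrier ?P" for x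
    using that P.l_neg P.a_inv_closed by auto
  then have "abelian_group ?P"
    by (intro abelian_groupI) (auto simp: P.a_ac)
  then have P': "left_module R ?P"
    by (intro left_module.intro left_module_axioms.intro M.R.ring_axioms)
      (auto simp: P.smult_closed P.smult_l_distr P.smult_r_distr P.smult_assoc P.smult_one)
  have "g \<circ> ?\<rho> \<in> mod_hom R ?M ?P"
    using g(1) by (auto simp: mod_hom_def Pi_iff M.smult_closed)
  moreover have "(g \<circ> ?\<rho>) ` carrier ?M = carrier ?P"
    using g(2) by (force simp: image_image)
  moreover have "(\<lambda>x. x) \<in> mod_hom R P ?P"
    by (auto simp: mod_hom_def)
  ultimately obtain h where h: "h \<in> mod_hom R P ?M" and gh: "\<forall>x\<in>carrier P. (g \<circ> ?\<rho>) (h x) = x"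
    using P M' P' unfolding projective_module_def by metis
  have "?\<rho> \<in> mod_hom R ?M M"
    by (auto simp: mod_hom_def M.smult_closed)
  then have "?\<rho> \<circ> h \<in> mod_hom R P M"
    using h by (rule mod_hom_comp [rotated])
  with gh show thesis by (intro that [of "?\<rho> \<circ> h"]) auto
qed

lemma left_module_direct_sum:
  assumes "left_module R M" "left_module R N"
  shows "left_module R (mod_direct_sum M N)"
proof -
  interpret M: left_module R M by (rule assms)
  interpret N: left_module R N by (rule assms)
  let ?S = "mod_direct_sum M N"
  have "\<exists>y\<in>carrier ?S. y \<oplus>\<^bsub>?S\<^esub> x = \<zero>\<^bsub>?S\<^esub>" if "x \<in> carrier ?S" for x
    using that
    by (intro bexI [of _ "(\<ominus>\<^bsub>M\<^esub> fst x, \<ominus>\<^bsub>N\<^esub> snd x)"]) (auto simp: mod_direct_sum_def M.l_neg N.l_neg)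
  then have "abelian_group ?S"
    by (intro abelian_groupI) (auto simp: mod_direct_sum_def M.a_ac N.a_ac)
  then show ?thesis
    by (intro left_module.intro left_module_axioms.intro M.R.ring_axioms)
      (auto simp: mod_direct_sum_def M.smult_closed M.smult_l_distr M.smult_r_distr M.smult_assoc M.smult_one
        N.smult_closed N.smult_l_distr N.smult_r_distr N.smult_assoc N.smult_one)
qed

section \<open>The module \<open>V\<^sub>1 \<otimes> V\<^sub>1\<close>\<close>

lemma V1_fields [simp]:
  "carrier V1 = UNIV" "add V1 = (+)" "\<zero>\<^bsub>V1\<^esub> = 0" "u \<odot>\<^bsub>V1\<^esub> v = V1_rep u *v v"
  by (simp_all add: V1_def)

lemma V0_fields [simp]:
  "carrier V0 = UNIV" "add V0 = (+)" "\<zero>\<^bsub>V0\<^esub> = 0" "u \<odot>\<^bsub>V0\<^esub> t = um_counit u * t"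
  by (simp_all add: V0_def)

lemma um_counit_simps:
  "um_counit (um_gen_elem x) = (0 :: 'k::field)" "um_counit (c \<odot>\<^bsub>um\<^esub> \<one>\<^bsub>um\<^esub>) = (c :: 'k)"
proof -
  interpret um_rep "field_algebra :: ('k, 'k) module" "\<lambda>_. 0" by (rule um_rep_counit)
  show "um_counit (um_gen_elem x :: 'k um) = 0" "um_counit (c \<odot>\<^bsub>um\<^esub> \<one>\<^bsub>um\<^esub>) = c"
    using quot_extend_gen [of x] quot_extend_scale [of "\<one>\<^bsub>um\<^esub>" c] quot_extend_one
    by (simp_all add: um_counit_def field_algebra_def)
qed

lemma outer_matrix_vector:
  "outer (X *v v) w = X ** outer v w" "outer v (Y *v w) = outer v w ** transpose Y"
  by (simp_all add: outer_def vec_eq_iff matrix_matrix_mult_def matrix_vector_mult_def transpose_def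
      sum_distrib_left sum_distrib_right mult_ac)

text \<open>The matrix of a tensor: \<open>v\<^sub>i \<otimes> v\<^sub>j\<close> goes to the elementary matrix with entry 1 at \<open>(i, j)\<close>, and a
  primitive element acting by \<open>X\<close> on \<open>V\<^sub>1\<close> acts on matrices by \<open>m \<mapsto> X m + m X\<^sup>T\<close>.\<close>

definition tensor_matrix :: "(('k::field ^ 3) \<times> ('k ^ 3) \<Rightarrow>\<^sub>0 'k) set \<Rightarrow> 'k ^ 3 ^ 3"
  where "tensor_matrix X = coord (SOME f. f \<in> X)"

text \<open>Contraction with the bilinear form on V1 that pairs v1 with v3 and v2 with
  itself.\<close>

definition trace_form :: "'k::field ^ 3 ^ 3 \<Rightarrow> 'k"
  where "trace_form m = m $ 1 $ 3 + m $ 2 $ 2 + m $ 3 $ 1"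

locale char_2 =
  fixes k :: "'k::field itself"
  assumes char: "CHAR('k) = 2"
begin

lemma double: "x + x = (0 :: 'k)" "x + (x + y) = (y :: 'k)" "2 * x = (0 :: 'k)"
proof -
  have "(1 + 1 :: 'k) = 0"
    using of_nat_CHAR [where 'a = 'k] char by simp
  then show "x + x = 0"
    by (metis distrib_left mult.right_neutral mult_zero_right)
  then show "x + (x + y) = y" by (simp flip: add.assoc)
  show "2 * x = 0" unfolding mult_2 by fact
qed

sublocale V1: um_module "V1 :: ('k um, 'k ^ 3) module"
  by (rule um_module.intro [OF left_module_V1 [OF char]])

sublocale VV: um_module_pair "V1 :: ('k um, 'k ^ 3) module" "V1 :: ('k um, 'k ^ 3) module"
  by unfold_locales (rule char)

sublocale VS: vec_spaces "restrict_scalars um (V1 :: ('k um, 'k ^ 3) module)"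
    "restrict_scalars um (V1 :: ('k um, 'k ^ 3) module)"
  by unfold_locales (simp_all add: V1_scalar [OF char])

abbreviation "VV \<equiv> um_tensor (V1 :: ('k um, 'k ^ 3) module) (V1 :: ('k um, 'k ^ 3) module)"
abbreviation "cls \<equiv> tensor_class (restrict_scalars um (V1 :: ('k um, 'k ^ 3) module))
  (restrict_scalars um (V1 :: ('k um, 'k ^ 3) module))"

sublocale T: um_module VV
  by (rule um_module.intro [OF VV.left_module_um_tensor])

lemma VV_carrier: "carrier VV = range cls"
  by (simp add: tensor_carrier)

lemma tensor_matrix_class: "tensor_matrix (cls f) = coord f"
proof -
  have "(SOME g. g \<in> cls f) \<in> cls f" by (rule someI) (rule tensor_class_self)
  then have "cls (SOME g. g \<in> cls f) = cls f"
    by (simp add: tensor_class_iff tensor_class_eq_iff)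
  then show ?thesis
    by (simp add: tensor_matrix_def VS.tensor_class_eq_iff_coord)
qed

lemma tensor_matrix_inj: "inj_on tensor_matrix (carrier VV)"
  unfolding VV_carrier
  by (auto simp: inj_on_def tensor_matrix_class VS.tensor_class_eq_iff_coord)

lemma tensor_matrix_surj: obtains t where "t \<in> carrier VV" "tensor_matrix t = m"
proof
  show "cls (mat_tensor m) \<in> carrier VV" unfolding VV_carrier by simp
  show "tensor_matrix (cls (mat_tensor m)) = m"
    by (simp add: tensor_matrix_class coord_mat_tensor)
qed

lemma tensor_matrix_add:
  "\<lbrakk>t \<in> carrier VV; t' \<in> carrier VV\<rbrakk> \<Longrightarrow>
    tensor_matrix (t \<oplus>\<^bsub>VV\<^esub> t') = tensor_matrix t + tensor_matrix t'"
  unfolding VV_carrier by (auto simp: tensor_add tensor_matrix_class coord_add)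

lemma tensor_matrix_zero: "tensor_matrix \<zero>\<^bsub>VV\<^esub> = 0"
  using tensor_matrix_add [of "\<zero>\<^bsub>VV\<^esub>" "\<zero>\<^bsub>VV\<^esub>"] T.r_zero [of "\<zero>\<^bsub>VV\<^esub>"] T.zero_closed by simp

lemma tensor_matrix_scalar:
  "t \<in> carrier VV \<Longrightarrow>
    tensor_matrix ((c \<odot>\<^bsub>um\<^esub> \<one>\<^bsub>um\<^esub>) \<odot>\<^bsub>VV\<^esub> t) = (\<chi> i j. c * tensor_matrix t $ i $ j)"
  unfolding VV_carrier
  using VV.um_tensor_scalar by (auto simp: tensor_matrix_class coord_scale)

lemma tensor_matrix_gen:
  assumes "t \<in> carrier VV"
  shows "tensor_matrix (um_gen_elem x \<odot>\<^bsub>VV\<^esub> t) =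
    V1_matrix x ** tensor_matrix t + tensor_matrix t ** transpose (V1_matrix x)"
proof -
  let ?X = "V1_matrix x :: 'k ^ 3 ^ 3"
  let ?g = "Poly_Mapping.single (um_gen_elem x, \<one>\<^bsub>um\<^esub>) 1 + Poly_Mapping.single (\<one>\<^bsub>um\<^esub>, um_gen_elem x) (1 :: 'k)"
  obtain f where t: "t = cls f" using assms unfolding VV_carrier by auto
  have "Poly_Mapping.keys f \<subseteq> UNIV" by simp
  then have "coord (tensor_rep (smult V1) (smult V1) ?g f) = ?X ** coord f + coord f ** transpose ?X"
  proof (induction rule: pm_induct)
    case zero
    then show ?case by (simp add: coord_def)
  next
    case (add f g)
    then show ?case
      by (simp add: tensor_rep_add_right coord_add matrix_add_ldistrib add_ac)
        (simp add: vec_eq_iff matrix_matrix_mult_def algebra_simps sum.distrib)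
  next
    case (scale c f)
    then show ?case
      by (simp add: tensor_rep_scale_right coord_scale)
        (simp add: vec_eq_iff matrix_matrix_mult_def algebra_simps sum_distrib_left)
  next
    case (single y)
    obtain v w where y: "y = (v, w)" by (rule prod.exhaust)
    have eta: "(\<chi> i j. outer v w $ i $ j) = outer v w" for v w :: "'k ^ 3"
      by (simp add: vec_eq_iff)
    show ?case
      by (simp add: y tensor_rep_add_left coord_add coord_single V1_rep_simps [OF char] eta
          outer_matrix_vector)
  qed
  then show ?thesis
    using VV.um_tensor_gen [of f x] by (simp add: t tensor_matrix_class)
qed

text \<open>Reversing the rows of each matrix \<open>V1_matrix g\<close> gives a symmetric matrix.
  In characteristic 2 this is invariance of the bilinear form under a, b and c, on which the counit
  vanishes.\<close>

lemma trace_form_hom: "(\<lambda>t. trace_form (tensor_matrix t)) \<in> mod_hom um VV (V0 :: ('k um, 'k) module)"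
proof (rule um_mod_homI)
  fix g t
  assume t: "t \<in> carrier VV"
  have "trace_form (V1_matrix g ** m + m ** transpose (V1_matrix g)) = 0" for m :: "'k ^ 3 ^ 3"
    by (cases g)
      (simp_all add: trace_form_def matrix_matrix_mult_def transpose_def sum_3 vector_3 ac_simps double)
  then show "trace_form (tensor_matrix (um_gen_elem g \<odot>\<^bsub>VV\<^esub> t)) =
      um_gen_elem g \<odot>\<^bsub>V0\<^esub> trace_form (tensor_matrix t)"
    unfolding tensor_matrix_gen [OF t] by (simp add: um_counit_simps)
next
  show "left_module um VV" by (rule VV.left_module_um_tensor)
  show "left_module um V0" by (rule left_module_V0)
  fix t t' c assume t: "t \<in> carrier VV"
  show "trace_form (tensor_matrix ((c \<odot>\<^bsub>um\<^esub> \<one>\<^bsub>um\<^esub>) \<odot>\<^bsub>VV\<^esub> t)) =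
      (c \<odot>\<^bsub>um\<^esub> \<one>\<^bsub>um\<^esub>) \<odot>\<^bsub>V0\<^esub> trace_form (tensor_matrix t)"
    unfolding tensor_matrix_scalar [OF t] by (simp add: um_counit_simps trace_form_def algebra_simps)
  assume "t' \<in> carrier VV"
  then show "trace_form (tensor_matrix (t \<oplus>\<^bsub>VV\<^esub> t')) =
      trace_form (tensor_matrix t) \<oplus>\<^bsub>V0\<^esub> trace_form (tensor_matrix t')"
    unfolding tensor_matrix_add [OF t \<open>t' \<in> carrier VV\<close>] by (simp add: trace_form_def algebra_simps)
qed simp

end

text \<open>The homomorphism from \<open>V\<^sub>1 \<otimes> V\<^sub>1\<close> that sends \<open>v\<^sub>2 \<otimes> v\<^sub>3\<close> to \<open>y\<close> and \<open>v\<^sub>3 \<otimes> v\<^sub>2\<close> to \<open>y + b a y\<close>.\<close>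

definition (in um_module) matrix_lc :: "'m \<Rightarrow> 'k ^ 3 ^ 3 \<Rightarrow> 'm"
  where "matrix_lc y m = lc y (m $ 2 $ 3 + m $ 3 $ 2) (m $ 3 $ 1 + m $ 1 $ 3) (m $ 2 $ 1 + m $ 1 $ 2) (m $ 1 $ 1)
    (m $ 3 $ 3) (m $ 3 $ 2) (m $ 1 $ 3 + m $ 2 $ 2) (m $ 1 $ 2)"

context um_vector
begin

sublocale F: char_2 "TYPE('k)"
  by unfold_locales (rule char)

text \<open>By \<open>lc_action\<close> both sides become \<open>lc y\<close> of eight linear forms
  in the entries of \<open>m\<close>, and these forms agree modulo 2. Equality of coefficients
  suffices, whatever relations hold between the eight elements.\<close>

lemma matrix_lc_gen:
  "matrix_lc y (V1_matrix g ** m + m ** transpose (V1_matrix g)) = um_gen_elem g \<odot> matrix_lc y m"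
proof (cases g)
  case Gen_a
  then show ?thesis
    by (simp add: matrix_lc_def lc_action matrix_matrix_mult_def transpose_def sum_3 vector_3)
      (simp add: ac_simps F.double)
next
  case Gen_b
  then show ?thesis
    by (simp add: matrix_lc_def lc_action matrix_matrix_mult_def transpose_def sum_3 vector_3)
      (simp add: ac_simps F.double)
next
  case Gen_c
  then show ?thesis
    by (simp add: matrix_lc_def lc_action matrix_matrix_mult_def transpose_def sum_3 vector_3)
      (simp add: ac_simps F.double)
qed

lemma matrix_lc_hom: "(\<lambda>t. matrix_lc y (tensor_matrix t)) \<in> mod_hom um F.VV M"
proof (rule um_mod_homI)
  show "left_module um F.VV" by (rule F.VV.left_module_um_tensor)
  show "left_module um M" by (rule left_module_axioms)
  show "matrix_lc y (tensor_matrix t) \<in> carrier M" for t by (simp add: matrix_lc_def)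
  fix t t' c g assume t: "t \<in> carrier F.VV"
  show "matrix_lc y (tensor_matrix (um_gen_elem g \<odot>\<^bsub>F.VV\<^esub> t)) = um_gen_elem g \<odot> matrix_lc y (tensor_matrix t)"
    unfolding F.tensor_matrix_gen [OF t] by (rule matrix_lc_gen)
  show "matrix_lc y (tensor_matrix ((c \<odot>\<^bsub>um\<^esub> \<one>\<^bsub>um\<^esub>) \<odot>\<^bsub>F.VV\<^esub> t)) =
      (c \<odot>\<^bsub>um\<^esub> \<one>\<^bsub>um\<^esub>) \<odot> matrix_lc y (tensor_matrix t)"
    unfolding F.tensor_matrix_scalar [OF t] matrix_lc_def sc_def [symmetric]
    by (simp add: sc_lc distrib_left)
  assume "t' \<in> carrier F.VV"
  then show "matrix_lc y (tensor_matrix (t \<oplus>\<^bsub>F.VV\<^esub> t')) =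
      matrix_lc y (tensor_matrix t) \<oplus> matrix_lc y (tensor_matrix t')"
    unfolding F.tensor_matrix_add [OF t \<open>t' \<in> carrier F.VV\<close>] matrix_lc_def
    by (simp add: lc_add) (simp add: ac_simps)
qed

end

text \<open>In characteristic 2 the relation c^2 + c = 0 makes c idempotent, and c commutes with a^2
  and b^2 because the commutator terms double. So a^2 b^2 c x has weight one, and a^4 = 0 gives the
  last condition. The image stays v3: c fixes v3, b^2 takes it to v1, and a^2 takes v1 back.\<close>

lemma (in um_module) exists_weight_vector:
  assumes char: "CHAR('k) = 2" and \<pi>: "\<pi> \<in> mod_hom um M V1" and onto: "\<pi> ` carrier M = carrier V1"
  obtains y where "y \<in> carrier M" "gc y = y" "ga (ga y) = \<zero>" "\<pi> y = axis 3 1"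
proof -
  obtain x where x: "x \<in> carrier M" "\<pi> x = axis 3 1"
    using onto by (metis UNIV_I V1_fields(1) imageE)
  note move = commutation [OF char]
  have dbl: "u \<oplus> (v \<oplus> v) = u" if "u \<in> carrier M" "v \<in> carrier M" for u v
    using that by (simp add: double_zero [OF char])
  have gc2: "gc (ga (ga z)) = ga (ga (gc z))" "gc (gb (gb z)) = gb (gb (gc z))" if "z \<in> carrier M" for z
    using that by (simp_all add: move smult_closed smult_r_distr a_assoc dbl)
  have "gc (gc x) = (um_gen_elem Gen_c \<otimes>\<^bsub>um\<^esub> um_gen_elem Gen_c \<oplus>\<^bsub>um\<^esub> um_gen_elem Gen_c) \<odot> x \<oplus> gc x"
    using x by (simp add: smult_l_distr smult_assoc smult_closed a_assoc dbl)
  also have "\<dots> = gc x"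
    unfolding um_relations(6) using x by (simp add: smult_zero_left smult_closed)
  finally have gcc: "gc (gc x) = gc x" .
  have a4: "ga (ga (ga (ga z))) = \<zero>" if "z \<in> carrier M" for z
  proof -
    have "ga (ga (ga (ga z))) = ((um_gen_elem Gen_a \<otimes>\<^bsub>um\<^esub> um_gen_elem Gen_a) \<otimes>\<^bsub>um\<^esub>
        (um_gen_elem Gen_a \<otimes>\<^bsub>um\<^esub> um_gen_elem Gen_a)) \<odot> z"
      using that by (simp add: smult_assoc smult_closed)
    then show ?thesis
      using that by (simp only: um_relations(4) smult_zero_left)
  qed
  show thesis
  proof (rule that [of "ga (ga (gb (gb (gc x))))"])
    show "\<pi> (ga (ga (gb (gb (gc x))))) = axis 3 1"
      using x
      by (simp add: mod_homD(3) [OF \<pi>] smult_closed V1_rep_simps [OF char])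
        (simp add: vec_eq_iff forall_3 matrix_vector_mult_def sum_3 vector_3 axis_def mat_def)
  qed (use x in \<open>simp_all add: smult_closed gc2 gcc a4\<close>)
qed

lemma mod_hom_lc:
  fixes M :: "('k::field um, 'm, 'y) module_scheme" and N :: "('k um, 'n, 'z) module_scheme"
  assumes M: "um_module M" and N: "um_module N" and h: "h \<in> mod_hom um M N" and y: "y \<in> carrier M"
  shows "h (um_module.lc M y c0 c1 c2 c3 d0 d1 d2 d3) = um_module.lc N (h y) c0 c1 c2 c3 d0 d1 d2 d3"
proof -
  interpret M: um_module M by (rule M)
  interpret N: um_module N by (rule N)
  have "h (M.sc c x) = N.sc c (h x)" if "x \<in> carrier M" for c x
    using that by (simp add: M.sc_def N.sc_def mod_homD(3) [OF h])
  then show ?thesis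
    using y by (simp add: M.lc_def N.lc_def mod_homD(2,3) [OF h] M.sc_simps M.smult_closed)
qed

section \<open>Explicit computations in V1 and its tensor square\<close>

context char_2
begin

text \<open>The powers of b carry v3 to v2, v1 and 0, while a kills it. Combined with
  \<open>mod_hom_lc\<close> this gives the covering map on the submodule generated by y.\<close>

lemma V1_lc: "V1.lc (axis 3 1) c0 c1 c2 c3 d0 d1 d2 d3 = vector [c2, c1, c0]"
  by (simp add: V1.lc_def V1.sc_def V1_scalar [OF char] V1_rep_simps [OF char])
    (simp add: vec_eq_iff forall_3 matrix_vector_mult_def sum_3 vector_3 axis_def mat_def)

text \<open>The elements b^2, b, 1 carry v3 to v1, v2, v3. The lemma encodes vectors of V1 by
  elements of \<open>um\<close>, the values taken by functions in the test modules for
  projectivity.\<close>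

lemma V1_generated:
  obtains u where "u \<in> carrier um" "V1_rep u *v axis 3 1 = (v :: 'k ^ 3)"
proof
  let ?b = "um_gen_elem Gen_b :: 'k um"
  let ?u = "(v $ 1) \<odot>\<^bsub>um\<^esub> (?b \<otimes>\<^bsub>um\<^esub> ?b) \<oplus>\<^bsub>um\<^esub> ((v $ 2) \<odot>\<^bsub>um\<^esub> ?b \<oplus>\<^bsub>um\<^esub> (v $ 3) \<odot>\<^bsub>um\<^esub> \<one>\<^bsub>um\<^esub>)"
  show "?u \<in> carrier um" by simp
  show "V1_rep ?u *v axis 3 1 = v"
    by (simp add: V1_rep_simps [OF char])
      (simp add: vec_eq_iff forall_3 matrix_vector_mult_def matrix_matrix_mult_def sum_3 vector_3
        axis_def mat_def)
qed

text \<open>On a tensor of basis vectors, c acts as 1 if exactly one index is 2 and as 0 otherwise,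
  which leaves four entries. As a^2 acts by a^2 \<otimes> 1 + 1 \<otimes> a^2, it carries v1
  \<otimes> v2 to v3 \<otimes> v2 and v2 \<otimes> v1 to v2 \<otimes> v3, so two more entries
  vanish.\<close>

lemma weight_vector_matrix:
  assumes q: "q \<in> carrier VV" and weight: "T.gc q = q" and kill: "T.ga (T.ga q) = \<zero>\<^bsub>VV\<^esub>"
  defines "Q \<equiv> tensor_matrix q"
  shows "Q $ 1 $ 1 = 0" "Q $ 1 $ 2 = 0" "Q $ 1 $ 3 = 0" "Q $ 2 $ 1 = 0" "Q $ 2 $ 2 = 0"
    "Q $ 3 $ 1 = 0" "Q $ 3 $ 3 = 0"
proof -
  let ?c = "V1_matrix Gen_c :: 'k ^ 3 ^ 3" and ?a = "V1_matrix Gen_a :: 'k ^ 3 ^ 3"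
  have c: "?c ** Q + Q ** transpose ?c = Q"
    using tensor_matrix_gen [OF q, of Gen_c] by (simp only: weight Q_def)
  then show "Q $ 1 $ 1 = 0" "Q $ 1 $ 3 = 0" "Q $ 2 $ 2 = 0" "Q $ 3 $ 1 = 0" "Q $ 3 $ 3 = 0"
    by (simp_all add: vec_eq_iff forall_3 matrix_matrix_mult_def transpose_def sum_3 vector_3 double)
  have "?a ** (?a ** Q + Q ** transpose ?a) + (?a ** Q + Q ** transpose ?a) ** transpose ?a = 0"
    using tensor_matrix_gen [OF T.smult_closed [OF um_gen_elem_closed q], of Gen_a Gen_a]
      tensor_matrix_gen [OF q, of Gen_a]
    by (simp only: kill Q_def tensor_matrix_zero)
  then show "Q $ 1 $ 2 = 0" "Q $ 2 $ 1 = 0"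
    by (simp_all add: vec_eq_iff forall_3 matrix_matrix_mult_def transpose_def sum_3 vector_3 double)
qed

text \<open>The matrix determines all eight coefficients: c3, c1, d0 form the diagonal; by \<alpha>
  + \<beta> = 1 the entries (1,2) and (2,1) add up to c2, and (2,3) and (3,2) to c0; then d1, d2, d3
  follow. This is the linear independence used for injectivity.\<close>

lemma tensor_matrix_lc:
  assumes q: "q \<in> carrier VV" and weight: "T.gc q = q" and kill: "T.ga (T.ga q) = \<zero>\<^bsub>VV\<^esub>"
    and norm: "tensor_matrix q $ 2 $ 3 + tensor_matrix q $ 3 $ 2 = 1"
  defines "\<alpha> \<equiv> tensor_matrix q $ 2 $ 3" and "\<beta> \<equiv> tensor_matrix q $ 3 $ 2"
  shows "tensor_matrix (T.lc q c0 c1 c2 c3 d0 d1 d2 d3) =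
    vector [vector [c3, \<beta> * c2 + d3, \<alpha> * c1 + d2],
            vector [\<alpha> * c2 + d3, c1, \<alpha> * c0 + d1],
            vector [\<beta> * c1 + d2, \<beta> * c0 + d1, d0]]"
proof -
  \<comment> \<open>With \<alpha> eliminated, one free parameter is left, and sums such as \<alpha>
    + \<beta> reduce to 1 by cancelling doubles.\<close>
  have norm': "\<alpha> = 1 + \<beta>"
    using norm double(2) [of \<beta> \<alpha>] by (simp add: \<alpha>_def \<beta>_def add_ac)
  have Q: "tensor_matrix q = vector [vector [0, 0, 0], vector [0, 0, 1 + \<beta>], vector [0, \<beta>, 0]]"
    using weight_vector_matrix [OF q weight kill] norm'
    by (simp add: vec_eq_iff forall_3 vector_3 \<alpha>_def \<beta>_def)
  have sc: "tensor_matrix (T.sc c t) = (\<chi> i j. c * tensor_matrix t $ i $ j)" if "t \<in> carrier VV" for c t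
    using tensor_matrix_scalar [OF that] by (simp only: T.sc_def)
  note closed = T.sc_simps(1) T.smult_closed q um_gen_elem_closed T.a_closed
  have qb: "tensor_matrix (T.gb q) = vector [vector [0, 0, 1 + \<beta>], vector [0, 1, 0], vector [\<beta>, 0, 0]]"
    unfolding tensor_matrix_gen [OF q] Q
    by (simp add: vec_eq_iff forall_3 matrix_matrix_mult_def transpose_def sum_3 vector_3 double add_ac)
  have qbb: "tensor_matrix (T.gb (T.gb q)) = vector [vector [0, \<beta>, 0], vector [1 + \<beta>, 0, 0], vector [0, 0, 0]]"
    unfolding tensor_matrix_gen [OF T.smult_closed [OF um_gen_elem_closed q]] qb
    by (simp add: vec_eq_iff forall_3 matrix_matrix_mult_def transpose_def sum_3 vector_3 double add_ac)
  have qbbb: "tensor_matrix (T.gb (T.gb (T.gb q))) = vector [vector [1, 0, 0], vector [0, 0, 0], vector [0, 0, 0]]"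
    by (subst tensor_matrix_gen, (intro closed)+, unfold qbb)
      (simp add: vec_eq_iff forall_3 matrix_matrix_mult_def transpose_def sum_3 vector_3 double add_ac)
  have qa: "tensor_matrix (T.ga q) = vector [vector [0, 0, 0], vector [0, 0, 0], vector [0, 0, 1]]"
    unfolding tensor_matrix_gen [OF q] Q
    by (simp add: vec_eq_iff forall_3 matrix_matrix_mult_def transpose_def sum_3 vector_3 double add_ac)
  have qba: "tensor_matrix (T.gb (T.ga q)) = vector [vector [0, 0, 0], vector [0, 0, 1], vector [0, 1, 0]]"
    by (subst tensor_matrix_gen, (intro closed)+, unfold qa)
      (simp add: vec_eq_iff forall_3 matrix_matrix_mult_def transpose_def sum_3 vector_3 double add_ac)
  have qbba: "tensor_matrix (T.gb (T.gb (T.ga q))) = vector [vector [0, 0, 1], vector [0, 0, 0], vector [1, 0, 0]]"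
    by (subst tensor_matrix_gen, (intro closed)+, unfold qba)
      (simp add: vec_eq_iff forall_3 matrix_matrix_mult_def transpose_def sum_3 vector_3 double add_ac)
  have qbbba: "tensor_matrix (T.gb (T.gb (T.gb (T.ga q)))) = vector [vector [0, 1, 0], vector [1, 0, 0], vector [0, 0, 0]]"
    by (subst tensor_matrix_gen, (intro closed)+, unfold qbba)
      (simp add: vec_eq_iff forall_3 matrix_matrix_mult_def transpose_def sum_3 vector_3 double add_ac)
  show ?thesis
    unfolding T.lc_def
    by (simp only: tensor_matrix_add sc closed Q qb qbb qbbb qa qba qbba qbbba norm')
      (simp add: vec_eq_iff forall_3 vector_3 algebra_simps)
qed

end

section \<open>The splitting of the tensor square\<close>

theorem proposition4p5:
  fixes P1 :: "('k::alg_closed_field um, 'p) module"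
  assumes "CHAR('k) = 2"
    and "projective_cover (um :: ('k, 'k um) module) P1 V1"
  shows "mod_isomorphic (um :: ('k, 'k um) module) (um_tensor V1 V1) (mod_direct_sum V0 P1)"
proof -
  have proj: "projective_module (um :: ('k, 'k um) module) P1"
    using assms(2) by (simp add: projective_cover_def)
  then have P1: "left_module um P1" by (simp add: projective_module_def)
  obtain \<pi> where \<pi>: "\<pi> \<in> mod_hom um P1 (V1 :: ('k um, 'k ^ 3) module)" and onto: "\<pi> ` carrier P1 = carrier V1"
    and kernel: "\<forall>H. submodule H (um :: ('k, 'k um) module) P1 \<and>
      H <+>\<^bsub>P1\<^esub> a_kernel P1 V1 \<pi> = carrier P1 \<longrightarrow> H = carrier P1"
    using assms(2) unfolding projective_cover_def by (elim conjE bexE) (rule that)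
  note superfluous = kernel [rule_format, OF conjI]
  interpret P: um_module P1 by (rule um_module.intro [OF P1])
  obtain y where y: "y \<in> carrier P1" "P.gc y = y" "P.ga (P.ga y) = \<zero>\<^bsub>P1\<^esub>" "\<pi> y = axis 3 1"
    using P.exists_weight_vector [OF assms(1) \<pi> onto] .
  interpret um_vector P1 y
    by unfold_locales (use assms(1) y in auto)
  define S where "S t = P.matrix_lc y (tensor_matrix t)" for t
  define \<epsilon> where "\<epsilon> t = trace_form (tensor_matrix t)" for t :: "(('k ^ 3) \<times> ('k ^ 3) \<Rightarrow>\<^sub>0 'k) set"
  have S: "S \<in> mod_hom um F.VV P1"
    using matrix_lc_hom by (simp add: S_def [abs_def])
  have \<epsilon>: "\<epsilon> \<in> mod_hom um F.VV V0"
    using F.trace_form_hom by (simp add: \<epsilon>_def [abs_def])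
  have \<pi>S: "\<pi> (P.matrix_lc y m) = vector [m $ 2 $ 1 + m $ 1 $ 2, m $ 3 $ 1 + m $ 1 $ 3, m $ 2 $ 3 + m $ 3 $ 2]"
    for m
    unfolding P.matrix_lc_def mod_hom_lc [OF P.um_module_axioms F.V1.um_module_axioms \<pi> y(1)] y(4)
    by (rule F.V1_lc)
  have S_onto: "S ` carrier F.VV = carrier P1"
  proof (rule superfluous)
    show "submodule (S ` carrier F.VV) um P1"
      by (rule submodule_image [OF F.VV.left_module_um_tensor P1 S])
    have "\<exists>h\<in>S ` carrier F.VV. \<exists>k\<in>a_kernel P1 V1 \<pi>. p = h \<oplus>\<^bsub>P1\<^esub> k" if p: "p \<in> carrier P1" for p
    proof -
      let ?v = "\<pi> p"
      \<comment> \<open>By \<open>\<pi>S\<close> each coordinate of \<open>\<pi> (S t)\<close> is a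
        sum of two matrix entries; the witness puts the coordinate of \<open>?v\<close> into one of
        them and zero into the other.\<close>
      obtain t where t: "t \<in> carrier F.VV"
        "tensor_matrix t = vector [vector [0, 0, 0], vector [?v $ 1, 0, ?v $ 3], vector [?v $ 2, 0, 0]]"
        using F.tensor_matrix_surj .
      have St: "S t \<in> carrier P1" by (rule mod_homD(1) [OF S t(1)])
      have "\<pi> (S t) = ?v"
        unfolding S_def \<pi>S t(2) by (simp add: vec_eq_iff forall_3 vector_3)
      moreover have "?v + ?v = 0"
        by (simp add: vec_eq_iff F.double)
      ultimately have "S t \<oplus>\<^bsub>P1\<^esub> p \<in> a_kernel P1 V1 \<pi>"
        using p St mod_homD(2) [OF \<pi> St p] by (simp add: a_kernel_def kernel_def)
      moreover have "p = S t \<oplus>\<^bsub>P1\<^esub> (S t \<oplus>\<^bsub>P1\<^esub> p)"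
        using p St by (simp add: double_left)
      ultimately show ?thesis using t(1) by blast
    qed
    then show "S ` carrier F.VV <+>\<^bsub>P1\<^esub> a_kernel P1 V1 \<pi> = carrier P1"
      using mod_homD(1) [OF S]
      by (fastforce simp: set_add_def' a_kernel_def kernel_def)
  qed
  txt \<open>A matrix \<open>m\<close> is recovered from the map sending \<open>p\<close> to an element of \<open>\<uu>(\<mm>)\<close> that carries
    \<open>v\<^sub>3\<close> to \<open>m (\<pi> p)\<close>.\<close>
  define u where "u v = (SOME u. u \<in> carrier um \<and> V1_rep u *v axis 3 1 = v)" for v :: "'k ^ 3"
  have u: "V1_rep (u v) *v axis 3 1 = v" for v
    using someI_ex [of "\<lambda>u. u \<in> carrier um \<and> V1_rep u *v axis 3 1 = v"] F.V1_generated [of v]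
    unfolding u_def by blast
  have inj: "inj_on (\<lambda>t p. u (tensor_matrix t *v \<pi> p)) (carrier F.VV)"
  proof (rule inj_onI)
    fix t t' assume t: "t \<in> carrier F.VV" "t' \<in> carrier F.VV"
      and "(\<lambda>p. u (tensor_matrix t *v \<pi> p)) = (\<lambda>p. u (tensor_matrix t' *v \<pi> p))"
    then have "tensor_matrix t *v \<pi> p = tensor_matrix t' *v \<pi> p" for p
      by (metis u)
    then have "tensor_matrix t *v v = tensor_matrix t' *v v" for v
      using onto by (metis UNIV_I V1_fields(1) imageE)
    then have "tensor_matrix t = tensor_matrix t'"
      by (simp add: matrix_eq)
    then show "t = t'"
      using F.tensor_matrix_inj t by (auto dest: inj_onD)
  qed
  obtain h where h: "h \<in> mod_hom um P1 F.VV" and Sh: "\<And>p. p \<in> carrier P1 \<Longrightarrow> S (h p) = p"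
    by (rule projective_section [OF proj F.VV.left_module_um_tensor S S_onto inj]) (rule that)
  let ?q = "h y"
  have q: "?q \<in> carrier F.VV" by (rule mod_homD(1) [OF h y(1)])
  have weight: "F.T.gc ?q = ?q"
    using mod_homD(3) [OF h um_gen_elem_closed y(1), of Gen_c] y(2) by simp
  have kill: "F.T.ga (F.T.ga ?q) = \<zero>\<^bsub>F.VV\<^esub>"
    using mod_homD(3) [OF h um_gen_elem_closed y(1), of Gen_a]
      mod_homD(3) [OF h um_gen_elem_closed P.smult_closed [OF um_gen_elem_closed y(1)], of Gen_a Gen_a]
      mod_hom_zero [OF P1 F.VV.left_module_um_tensor h] y(3)
    by (simp del: um_tensor_fields)
  \<comment> \<open>This is the third coordinate of \<pi> (S (h y)) = \<pi> y = v3.\<close>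
  have norm: "tensor_matrix ?q $ 2 $ 3 + tensor_matrix ?q $ 3 $ 2 = 1"
    using \<pi>S [of "tensor_matrix ?q"] Sh [OF y(1)] y(4)
    by (auto simp: S_def vec_eq_iff forall_3 vector_3 axis_def)
  \<comment> \<open>Applying \<open>h\<close> to \<open>S t\<close> gives a combination of the eight
    elements built on \<open>h y\<close>. Their independence makes all coefficients zero, which
    leaves a multiple of the invariant vector, and the form excludes nonzero multiples.\<close>
  have injective: "tensor_matrix t = 0" if t: "t \<in> carrier F.VV" "S t = \<zero>\<^bsub>P1\<^esub>" "\<epsilon> t = 0" for t
  proof -
    let ?m = "tensor_matrix t"
    have "h (S t) = F.T.matrix_lc ?q ?m"
      unfolding S_def P.matrix_lc_def F.T.matrix_lc_def
      by (rule mod_hom_lc [OF P.um_module_axioms F.T.um_module_axioms h y(1)])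
    then have "tensor_matrix (F.T.matrix_lc ?q ?m) = 0"
      using t(2) mod_hom_zero [OF P1 F.VV.left_module_um_tensor h] F.tensor_matrix_zero by simp
    then have eqs: "?m $ 1 $ 1 = 0" "?m $ 3 $ 3 = 0" "?m $ 3 $ 1 + ?m $ 1 $ 3 = 0" "?m $ 1 $ 3 + ?m $ 2 $ 2 = 0"
        and eq_c0: "tensor_matrix ?q $ 2 $ 3 * (?m $ 2 $ 3 + ?m $ 3 $ 2) + ?m $ 3 $ 2 = 0"
          "tensor_matrix ?q $ 3 $ 2 * (?m $ 2 $ 3 + ?m $ 3 $ 2) + ?m $ 3 $ 2 = 0"
        and eq_c2: "tensor_matrix ?q $ 2 $ 3 * (?m $ 2 $ 1 + ?m $ 1 $ 2) + ?m $ 1 $ 2 = 0"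
          "tensor_matrix ?q $ 3 $ 2 * (?m $ 2 $ 1 + ?m $ 1 $ 2) + ?m $ 1 $ 2 = 0"
      unfolding F.T.matrix_lc_def F.tensor_matrix_lc [OF q weight kill norm]
      by (auto simp: vec_eq_iff forall_3 vector_3)
    \<comment> \<open>Adding the two equations removes d and leaves (\<alpha> + \<beta>) c =
      c.\<close>
    have cancel: "c = 0" if "tensor_matrix ?q $ 2 $ 3 * c + d = 0" "tensor_matrix ?q $ 3 $ 2 * c + d = 0" for c d
    proof -
      have "c = (tensor_matrix ?q $ 2 $ 3 + tensor_matrix ?q $ 3 $ 2) * c + (d + d)"
        by (simp add: norm F.double)
      also have "\<dots> = (tensor_matrix ?q $ 2 $ 3 * c + d) + (tensor_matrix ?q $ 3 $ 2 * c + d)"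
        by (simp only: distrib_right add_ac)
      finally show ?thesis using that by simp
    qed
    have "?m $ 3 $ 2 = 0" "?m $ 2 $ 3 = 0"
      using cancel [OF eq_c0] eq_c0 by auto
    moreover have "?m $ 1 $ 2 = 0" "?m $ 2 $ 1 = 0"
      using cancel [OF eq_c2] eq_c2 by auto
    \<comment> \<open>By \<open>eqs\<close> the entries (1,3), (2,2) and (3,1) agree, and the form
      adds three copies of this value, which is the value itself.\<close>
    moreover have "?m $ 1 $ 3 = 0"
      using t(3) eqs(3) eqs(4) F.double by (simp add: \<epsilon>_def trace_form_def)
    ultimately show ?thesis
      using eqs by (simp add: vec_eq_iff forall_3)
  qed
  define \<Phi> where "\<Phi> t = (\<epsilon> t, S t)" for t
  have "\<Phi> \<in> mod_hom um F.VV (mod_direct_sum V0 P1)"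
    using \<epsilon> S by (auto simp: mod_hom_def mod_direct_sum_def \<Phi>_def Pi_iff)
  moreover have "bij_betw \<Phi> (carrier F.VV) (carrier (mod_direct_sum V0 P1))"
  proof (rule bij_betw_imageI)
    show "inj_on \<Phi> (carrier F.VV)"
    proof (rule inj_onI)
      fix t t' assume t: "t \<in> carrier F.VV" "t' \<in> carrier F.VV" and "\<Phi> t = \<Phi> t'"
      then have eq: "\<epsilon> t = \<epsilon> t'" "S t = S t'" by (simp_all add: \<Phi>_def)
      \<comment> \<open>In characteristic 2 the sum serves as the difference.\<close>
      have "tensor_matrix (t \<oplus>\<^bsub>F.VV\<^esub> t') = 0"
      proof (rule injective)
        show "t \<oplus>\<^bsub>F.VV\<^esub> t' \<in> carrier F.VV" using t by (rule F.T.a_closed)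
        show "S (t \<oplus>\<^bsub>F.VV\<^esub> t') = \<zero>\<^bsub>P1\<^esub>"
          using mod_homD(2) [OF S t] mod_homD(1) [OF S t(2)] P.double_zero [OF assms(1)]
          by (simp only: eq)
        show "\<epsilon> (t \<oplus>\<^bsub>F.VV\<^esub> t') = 0"
          using mod_homD(2) [OF \<epsilon> t] by (simp only: eq V0_fields F.double)
      qed
      then have "tensor_matrix t + tensor_matrix t' = 0"
        by (simp only: F.tensor_matrix_add [OF t])
      then have "tensor_matrix t = tensor_matrix t'"
      proof -
        have "a = b" if "a + b = 0" for a b :: 'k
          using that F.double(2) [of b a] by (simp add: add.commute)
        then show ?thesis
          using \<open>tensor_matrix t + tensor_matrix t' = 0\<close> by (simp add: vec_eq_iff)
      qed
      then show "t = t'"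
        using F.tensor_matrix_inj t by (auto dest: inj_onD)
    qed
    have in_image: "(e, p) \<in> \<Phi> ` carrier F.VV" if p: "p \<in> carrier P1" for e p
    proof -
      obtain t where t: "t \<in> carrier F.VV" "p = S t"
        using p unfolding S_onto [symmetric] by (elim imageE) (rule that)
      \<comment> \<open>S already has the right value at \<open>t\<close>. The form is corrected by
        \<open>?e\<close> times the invariant vector: S kills it, its form is 3 times
        \<open>?e\<close>, that is \<open>?e\<close>, and the summand \<open>\<epsilon> t\<close> in
        \<open>?e\<close> cancels the contribution of \<open>t\<close>.\<close>
      let ?e = "e + \<epsilon> t"
      obtain t' where t': "t' \<in> carrier F.VV"
        "tensor_matrix t' = vector [vector [0, 0, ?e], vector [0, ?e, 0], vector [?e, 0, 0]]"
        using F.tensor_matrix_surj .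
      have "P.lc y 0 0 0 0 0 0 0 0 = \<zero>\<^bsub>P1\<^esub>"
        using y(1) by (simp add: P.lc_def P.sc_simps(6) P.smult_closed)
      then have St': "S t' = \<zero>\<^bsub>P1\<^esub>"
        unfolding S_def P.matrix_lc_def t'(2) by (simp only: vector_3 F.double add_0)
      have "S (t' \<oplus>\<^bsub>F.VV\<^esub> t) = p"
        unfolding mod_homD(2) [OF S t'(1) t(1)] St' t(2) [symmetric] using p by (rule P.l_zero)
      moreover have \<epsilon>t': "\<epsilon> t' = ?e"
        unfolding \<epsilon>_def trace_form_def t'(2) by (simp only: vector_3 F.double add_0)
      have "\<epsilon> (t' \<oplus>\<^bsub>F.VV\<^esub> t) = e + (\<epsilon> t + \<epsilon> t)"
        unfolding mod_homD(2) [OF \<epsilon> t'(1) t(1)] \<epsilon>t' V0_fields by (rule add.assoc)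
      then have "\<epsilon> (t' \<oplus>\<^bsub>F.VV\<^esub> t) = e"
        by (simp only: F.double add_0_right)
      ultimately have "(e, p) = \<Phi> (t' \<oplus>\<^bsub>F.VV\<^esub> t)"
        by (simp only: \<Phi>_def)
      then show ?thesis
        using F.T.a_closed [OF t'(1) t(1)] by (rule image_eqI)
    qed
    have image: "\<Phi> t \<in> UNIV \<times> carrier P1" if "t \<in> carrier F.VV" for t
      using mod_homD(1) [OF S that] by (simp add: \<Phi>_def)
    show "\<Phi> ` carrier F.VV = carrier (mod_direct_sum V0 P1)"
    proof (intro equalityI subsetI)
      show "z \<in> carrier (mod_direct_sum V0 P1)" if "z \<in> \<Phi> ` carrier F.VV" for z
        using that by (elim imageE) (simp only: image mod_direct_sum_def partial_object.select_convs V0_fields)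
      show "z \<in> \<Phi> ` carrier F.VV" if "z \<in> carrier (mod_direct_sum V0 P1)" for z
        using that in_image [of "snd z" "fst z"] by (cases z) (simp add: mod_direct_sum_def del: um_tensor_fields)
    qed
  qed
  ultimately show ?thesis
    unfolding mod_isomorphic_def
    by (intro conjI bexI F.VV.left_module_um_tensor left_module_direct_sum left_module_V0 P1)
qed

end
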